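(* Let $K$ be a finite simplicial complex embedded in $\mathbb{R}^{d+1}$, with real weights $w_1,\dots,w_m$ on its $d$-simplices, and let $\mathbf{c}\in\mathbb{Z}^m$ be a $d$-chain in $K$. Then an optimal chain homologous to $\mathbf{c}$ can be computed by a linear program. That is, the linear program $$\min\ \sum_{i}|w_i|(x_i^++x_i^-)\quad\text{subject to}\quad \mathbf{x}^+-\mathbf{x}^-=\mathbf{c}+[\partial_{d+1}]\,\mathbf{y},\quad \mathbf{x}^+,\mathbf{x}^-\ge\mathbf{0},$$ over real vectors $\mathbf{x}^+,\mathbf{x}^-\in\mathbb{R}^m$, $\mathbf{y}\in\mathbb{R}^n$, has an optimal solution with $\mathbf{x}^+,\mathbf{x}^-,\mathbf{y}$ all integral, and for such a solution the chain $\mathbf{x}^+-\mathbf{x}^-$ is an optimal chain homologous to $\mathbf{c}$.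
   Context: Each simplex of $K$ is given an arbitrary fixed orientation, and chains have $\mathbb{Z}$ coefficients. $m$ and $n$ are the numbers of $d$- and $(d+1)$-simplices of $K$, and $[\partial_{d+1}]$ is the $m\times n$ matrix of the simplicial boundary operator $\partial_{d+1}\colon C_{d+1}(K)\to C_d(K)$ in the bases of oriented simplices. A $d$-chain is identified with its coefficient vector in $\mathbb{Z}^m$. A chain $\mathbf{x}\in\mathbb{Z}^m$ is homologous to $\mathbf{c}$ if $\mathbf{x}=\mathbf{c}+[\partial_{d+1}]\mathbf{y}$ for some $\mathbf{y}\in\mathbb{Z}^n$; it is optimal if it minimizes $\sum_i|w_i||x_i|$ among all integer chains homologous to $\mathbf{c}$. *)

theory Defs
  imports "HOL-Analysis.Analysis"
begin

text \<open>
  A finite simplicial complex is the library's \<open>simplicial_complex K\<close>: a finite set of geometric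
  simplices in some Euclidean space, closed under faces and meeting along common faces. Every
  finite abstract complex has such a realization. The library also counts the empty set as a simplex (of
  dimension -1), so that every nonempty complex contains it; it plays no role below.
\<close>

definition simplices :: "'a::euclidean_space set set \<Rightarrow> nat \<Rightarrow> 'a set set" where
  "simplices K k = {S \<in> K. int k simplex S}"

text \<open>
  The orientation of a simplex \<open>S\<close> is the class, modulo even permutations, of the
  ordering \<open>ori S\<close> of its vertices.
\<close>

definition orientation :: "'a::euclidean_space set set \<Rightarrow> ('a set \<Rightarrow> 'a list) \<Rightarrow> bool" where
  "orientation K ori \<longleftrightarrow>
     (\<forall>S\<in>K. distinct (ori S) \<and> set (ori S) = {v. v extreme_point_of S})"

text \<open>Meaningful when \<open>xs\<close> and \<open>ys\<close> are distinct lists of the same elements.\<close>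

definition reordering_sign :: "'a list \<Rightarrow> 'a list \<Rightarrow> int" where
  "reordering_sign xs ys =
     sign (THE p. p permutes {..<length xs} \<and> permute_list p xs = ys)"

text \<open>
  The oriented simplex \<open>[v\<^sub>0,\<dots>,v\<^sub>k]\<close> as a chain: plus or minus the basis element belonging to
  the simplex spanned by these vertices, according to whether \<open>ori\<close> orients that simplex in
  the same or in the opposite way.
\<close>

definition oriented_simplex :: "('a::euclidean_space set \<Rightarrow> 'a list) \<Rightarrow> 'a list \<Rightarrow> 'a set \<Rightarrow> int" where
  "oriented_simplex ori vs F =
     (if F = convex hull (set vs) then reordering_sign (ori F) vs else 0)"

text \<open>
  \<open>\<partial>[v\<^sub>0,\<dots>,v\<^sub>k] = (\<Sum>i\<le>k. (-1)^i [v\<^sub>0,\<dots>,v\<^sub>i\<^sub>-\<^sub>1,v\<^sub>i\<^sub>+\<^sub>1,\<dots>,v\<^sub>k])\<close>. Chains and coefficient vectors of degree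
  \<open>k\<close> are functions on simplices of which only the values on \<open>simplices K k\<close> are relevant.
\<close>

definition boundary ::
  "'a::euclidean_space set set \<Rightarrow> ('a set \<Rightarrow> 'a list) \<Rightarrow> nat \<Rightarrow> ('a set \<Rightarrow> int) \<Rightarrow> 'a set \<Rightarrow> int" where
  "boundary K ori k z F =
     (\<Sum>S\<in>simplices K k. z S *
        (\<Sum>i<length (ori S).
           (-1) ^ i * oriented_simplex ori (take i (ori S) @ drop (Suc i) (ori S)) F))"

text \<open>The rows \<open>F\<close> are indexed by \<open>simplices K (k - 1)\<close>, the columns \<open>S\<close> by \<open>simplices K k\<close>.\<close>

definition boundary_matrix ::
  "'a::euclidean_space set set \<Rightarrow> ('a set \<Rightarrow> 'a list) \<Rightarrow> nat \<Rightarrow> 'a set \<Rightarrow> 'a set \<Rightarrow> int" where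
  "boundary_matrix K ori k F S = boundary K ori k (\<lambda>T. of_bool (T = S)) F"

definition homologous ::
  "'a::euclidean_space set set \<Rightarrow> ('a set \<Rightarrow> 'a list) \<Rightarrow> nat \<Rightarrow> ('a set \<Rightarrow> int) \<Rightarrow> ('a set \<Rightarrow> int) \<Rightarrow> bool"
  where
  "homologous K ori d c x \<longleftrightarrow>
     (\<exists>y :: 'a set \<Rightarrow> int. \<forall>F\<in>simplices K d.
        x F = c F + (\<Sum>S\<in>simplices K (d + 1). boundary_matrix K ori (d + 1) F S * y S))"

definition optimal_chain ::
  "'a::euclidean_space set set \<Rightarrow> ('a set \<Rightarrow> 'a list) \<Rightarrow> nat \<Rightarrow> ('a set \<Rightarrow> real) \<Rightarrow>
   ('a set \<Rightarrow> int) \<Rightarrow> ('a set \<Rightarrow> int) \<Rightarrow> bool" where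
  "optimal_chain K ori d w c x \<longleftrightarrow>
     homologous K ori d c x \<and>
     (\<forall>x'. homologous K ori d c x' \<longrightarrow>
        (\<Sum>F\<in>simplices K d. \<bar>w F\<bar> * \<bar>real_of_int (x F)\<bar>)
          \<le> (\<Sum>F\<in>simplices K d. \<bar>w F\<bar> * \<bar>real_of_int (x' F)\<bar>))"

definition lp_feasible ::
  "'a::euclidean_space set set \<Rightarrow> ('a set \<Rightarrow> 'a list) \<Rightarrow> nat \<Rightarrow> ('a set \<Rightarrow> int) \<Rightarrow>
   ('a set \<Rightarrow> real) \<Rightarrow> ('a set \<Rightarrow> real) \<Rightarrow> ('a set \<Rightarrow> real) \<Rightarrow> bool" where
  "lp_feasible K ori d c xp xm y \<longleftrightarrow>
     (\<forall>F\<in>simplices K d.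
        xp F - xm F = real_of_int (c F)
          + (\<Sum>S\<in>simplices K (d + 1). real_of_int (boundary_matrix K ori (d + 1) F S) * y S)
        \<and> 0 \<le> xp F \<and> 0 \<le> xm F)"

definition lp_objective ::
  "'a::euclidean_space set set \<Rightarrow> nat \<Rightarrow> ('a set \<Rightarrow> real) \<Rightarrow> ('a set \<Rightarrow> real) \<Rightarrow> ('a set \<Rightarrow> real) \<Rightarrow> real"
  where
  "lp_objective K d w xp xm = (\<Sum>F\<in>simplices K d. \<bar>w F\<bar> * (xp F + xm F))"

definition lp_optimal ::
  "'a::euclidean_space set set \<Rightarrow> ('a set \<Rightarrow> 'a list) \<Rightarrow> nat \<Rightarrow> ('a set \<Rightarrow> real) \<Rightarrow> ('a set \<Rightarrow> int) \<Rightarrow>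
   ('a set \<Rightarrow> real) \<Rightarrow> ('a set \<Rightarrow> real) \<Rightarrow> ('a set \<Rightarrow> real) \<Rightarrow> bool" where
  "lp_optimal K ori d w c xp xm y \<longleftrightarrow>
     lp_feasible K ori d c xp xm y \<and>
     (\<forall>xp' xm' y'. lp_feasible K ori d c xp' xm' y' \<longrightarrow>
        lp_objective K d w xp xm \<le> lp_objective K d w xp' xm')"

end

theory Submission
  imports Defs "HOL-Homology.Homology" "HOL-Combinatorics.Permutations"
begin

text \<open>
  Suppose the \<open>(d + 1)\<close>-simplices carry signs \<open>\<epsilon>\<close> such that, after multiplying the columns of the
  boundary matrix by them, every row contains at most one \<open>1\<close> and at most one \<open>-1\<close>. Then the
  linear program is integral by randomised rounding: substituting \<open>\<lfloor>y S + \<theta>\<rfloor>\<close> for \<open>y S\<close>, with one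
  \<open>\<theta>\<close> uniform in \<open>[0, 1]\<close>, keeps the expectation of each \<open>\<bar>x F\<bar>\<close>, since a row is the difference
  of at most two values plus an integer.

  The sign of a simplex is the local degree, at an interior point, of the embedding into
  \<open>\<real>\<^sup>d\<^sup>+\<^sup>1\<close> read in the affine coordinates given by the ordering of the vertices. It is \<open>\<plusminus>1\<close> by
  invariance of domain and changes sign under transpositions of the vertices. If two simplices with
  vertices \<open>a, v\<^sub>0, \<dots>, v\<^sub>d\<close> and \<open>b, v\<^sub>0, \<dots>, v\<^sub>d\<close> share the facet \<open>v\<^sub>0, \<dots>, v\<^sub>d\<close>, moving
  the interior point across the facet shows that their degrees are opposite. This gives the sign
  condition, and also excludes a third simplex at the same facet.
\<close>

subsection \<open>Degrees of maps into Euclidean space minus the origin\<close>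

text \<open>The embedding is merely topological, so its restriction to a simplex has no determinant
  whose sign could orient it; the local degree replaces that sign. As \<open>K\<close> itself may
  lie in a space of any dimension, the source is always read in barycentric coordinates. A degree
  needs the map, minus its value at the centre, to have no zeros. Injectivity provides this wherever
  the centre and the sphere about it stay inside one simplex, or inside two adjacent ones; the
  scaling constants of the frames are chosen for that purpose. A third simplex at a facet is
  impossible because three numbers of absolute value 1 cannot be pairwise opposite. Rounding
  compares a real \<open>y\<close> with integer points directly, so neither vertices of polyhedra
  nor determinants of submatrices occur, and the existence of an optimum of the linear program
  reduces to that of an optimal integer chain. The weights are arbitrary reals and may vanish, so
  the latter rests on the objective taking only finitely many values below any bound.\<close>

definition comb :: "(nat \<Rightarrow> 'a::real_vector) \<Rightarrow> nat \<Rightarrow> (nat \<Rightarrow> real) \<Rightarrow> 'a" where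
  "comb b d x = (\<Sum>i\<le>d. x i *\<^sub>R b i)"

text \<open>Radial projection to the unit sphere, in the coordinates of \<beta>. The zero tail is
  what points of \<open>nsphere d\<close> have beyond index \<open>d\<close>.\<close>

definition direction :: "(nat \<Rightarrow> 'b::euclidean_space) \<Rightarrow> nat \<Rightarrow> 'b \<Rightarrow> nat \<Rightarrow> real" where
  "direction \<beta> d v i = (if i \<le> d then (v \<bullet> \<beta> i) / norm v else 0)"

definition unit_sphere :: "nat \<Rightarrow> (nat \<Rightarrow> real) set" where
  "unit_sphere d = {x. (\<Sum>i\<le>d. (x i)\<^sup>2) = 1 \<and> (\<forall>i>d. x i = 0)}"

text \<open>The winding number about the origin of a map without zeros on the sphere.\<close>

definition sphere_degree :: "(nat \<Rightarrow> 'b::euclidean_space) \<Rightarrow> nat \<Rightarrow> ((nat \<Rightarrow> real) \<Rightarrow> 'b) \<Rightarrow> int" where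
  "sphere_degree \<beta> d \<phi> = Brouwer_degree2 d (\<lambda>x. direction \<beta> d (\<phi> x))"

lemma nsphere_unit_sphere: "nsphere d = top_of_set (unit_sphere d)"
  by (simp add: nsphere unit_sphere_def euclidean_product_topology)

lemma continuous_map_nsphere_iff:
  "continuous_map (nsphere d) (nsphere d) h \<longleftrightarrow>
     continuous_on (unit_sphere d) h \<and> h \<in> unit_sphere d \<rightarrow> unit_sphere d"
  by (auto simp: nsphere_unit_sphere continuous_map_in_subtopology)

lemma unit_sphere_abs_le:
  assumes "x \<in> unit_sphere d"
  shows "\<bar>x i\<bar> \<le> 1"
proof (cases "i \<le> d")
  case True
  have "(x i)\<^sup>2 \<le> (\<Sum>i\<le>d. (x i)\<^sup>2)"
    by (rule member_le_sum) (use True in auto)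
  then show ?thesis
    using assms by (simp add: unit_sphere_def abs_square_le_1)
qed (use assms in \<open>auto simp: unit_sphere_def\<close>)

lemma unit_sphere_nonzero: "x \<in> unit_sphere d \<Longrightarrow> \<exists>i\<le>d. x i \<noteq> 0"
  by (rule ccontr) (auto simp: unit_sphere_def)

lemma unit_sphere_permute:
  assumes "p permutes {..d}" "x \<in> unit_sphere d"
  shows "x \<circ> p \<in> unit_sphere d"
  using assms sum.permute[OF assms(1), of "\<lambda>i. (x i)\<^sup>2"]
  by (auto simp: unit_sphere_def o_def permutes_def)

lemma unit_sphere_reflect:
  assumes "x \<in> unit_sphere d"
  shows "x(k := - x k) \<in> unit_sphere d"
proof -
  have "((x(k := - x k)) i)\<^sup>2 = (x i)\<^sup>2" for i
    by simp
  then show ?thesis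
    using assms by (auto simp: unit_sphere_def)
qed

lemma continuous_on_coordinate: "continuous_on S (\<lambda>x::nat \<Rightarrow> real. x i)"
  by (rule continuous_on_subset[OF continuous_on_product_coordinates]) simp

lemma continuous_on_comb [continuous_intros]:
  fixes h :: "'c::topological_space \<Rightarrow> nat \<Rightarrow> real" and b :: "'c \<Rightarrow> nat \<Rightarrow> 'a::real_normed_vector"
  assumes "continuous_on S h" "\<And>i. continuous_on S (\<lambda>x. b x i)"
  shows "continuous_on S (\<lambda>x. comb (b x) d (h x))"
  unfolding comb_def
  by (intro continuous_on_sum continuous_on_scaleR assms(2)
      continuous_on_product_then_coordinatewise[OF assms(1)])

lemma continuous_on_direction [continuous_intros]:
  fixes h :: "'c::topological_space \<Rightarrow> 'b::euclidean_space"
  assumes "continuous_on S h" "\<And>x. x \<in> S \<Longrightarrow> h x \<noteq> 0"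
  shows "continuous_on S (\<lambda>x. direction \<beta> d (h x))"
proof (rule continuous_on_coordinatewise_then_product)
  show "continuous_on S (\<lambda>x. direction \<beta> d (h x) i)" for i
    unfolding direction_def
    by (cases "i \<le> d") (auto intro!: continuous_intros assms(1) simp: assms(2))
qed

lemma continuous_on_reflect: "continuous_on S (\<lambda>x::nat \<Rightarrow> real. x(k := - x k))"
proof (rule continuous_on_coordinatewise_then_product)
  show "continuous_on S (\<lambda>x. (x(k := - x k)) i)" for i
    by (cases "i = k") (auto intro!: continuous_intros continuous_on_coordinate)
qed

lemma continuous_on_permute: "continuous_on S (\<lambda>x::nat \<Rightarrow> real. x \<circ> p)"
  unfolding o_def
  by (rule continuous_on_coordinatewise_then_product) (rule continuous_on_coordinate)

lemma comb_scaleR: "comb (\<lambda>i. r *\<^sub>R b i) d x = r *\<^sub>R comb b d x"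
  by (simp add: comb_def scaleR_sum_right mult.commute)

lemma comb_cmul: "comb b d (\<lambda>i. r * x i) = r *\<^sub>R comb b d x"
  by (simp add: comb_def scaleR_sum_right)

lemma comb_reflect: "comb b d (x(k := - x k)) = comb (b(k := - b k)) d x"
  unfolding comb_def by (intro sum.cong) auto

text \<open>The transposition \<tau> conjugates this reflection to the one in coordinate 0. As
  \<tau> is an involution, its degree squares to 1, so the value itself never has to be
  known.\<close>

lemma degree_reflection:
  assumes "k \<le> d"
  shows "Brouwer_degree2 d (\<lambda>x. x(k := - x k)) = -1"
proof -
  define \<tau> where "\<tau> = (\<lambda>x::nat \<Rightarrow> real. x \<circ> Transposition.transpose 0 k)"
  define r where "r = (\<lambda>x::nat \<Rightarrow> real. x(0 := - x 0))"
  have "Transposition.transpose 0 k permutes {..d}"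
    using assms by (intro permutes_swap_id) auto
  then have \<tau>: "continuous_map (nsphere d) (nsphere d) \<tau>"
    unfolding continuous_map_nsphere_iff \<tau>_def
    by (auto intro: unit_sphere_permute continuous_on_permute)
  have r: "continuous_map (nsphere d) (nsphere d) r"
    unfolding continuous_map_nsphere_iff r_def
    by (auto intro: unit_sphere_reflect continuous_on_reflect)
  have "\<tau> \<circ> \<tau> = id"
    by (auto simp: \<tau>_def fun_eq_iff)
  then have 1: "Brouwer_degree2 d \<tau> * Brouwer_degree2 d \<tau> = 1"
    using Brouwer_degree2_compose[OF \<tau> \<tau>] by simp
  have "r = (\<lambda>x i. if i = 0 then - x i else x i)"
    by (simp add: r_def fun_eq_iff)
  then have 2: "Brouwer_degree2 d r = -1"
    by (simp only: Brouwer_degree2_reflection)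
  have "(\<lambda>x. x(k := - x k)) = \<tau> \<circ> (r \<circ> \<tau>)"
    by (auto simp: \<tau>_def r_def fun_eq_iff Transposition.transpose_def)
  then have "Brouwer_degree2 d (\<lambda>x. x(k := - x k)) = Brouwer_degree2 d (\<tau> \<circ> (r \<circ> \<tau>))"
    by (rule arg_cong)
  also have "\<dots> = Brouwer_degree2 d \<tau> * (Brouwer_degree2 d r * Brouwer_degree2 d \<tau>)"
    by (simp only: Brouwer_degree2_compose[OF continuous_map_compose[OF \<tau> r] \<tau>] Brouwer_degree2_compose[OF \<tau> r])
  finally show ?thesis using 1 2 by simp
qed

text \<open>An enumeration of \<open>Basis\<close> identifies the target with the coordinate space
  in which \<open>nsphere d\<close> lies, and thereby fixes an orientation of it.\<close>

locale orthonormal_frame =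
  fixes \<beta> :: "nat \<Rightarrow> 'b::euclidean_space" and d :: nat
  assumes bij: "bij_betw \<beta> {..d} Basis"
begin

lemma sum_Basis: "(\<Sum>b\<in>Basis. h b) = (\<Sum>i\<le>d. h (\<beta> i))"
  using sum.reindex_bij_betw[OF bij, of h] by simp

lemma direction_in_sphere:
  assumes "v \<noteq> 0"
  shows "direction \<beta> d v \<in> unit_sphere d"
proof -
  have "(\<Sum>i\<le>d. (direction \<beta> d v i)\<^sup>2) = (\<Sum>i\<le>d. (v \<bullet> \<beta> i)\<^sup>2) / (norm v)\<^sup>2"
    by (simp add: direction_def power_divide sum_divide_distrib)
  also have "(\<Sum>i\<le>d. (v \<bullet> \<beta> i)\<^sup>2) = (norm v)\<^sup>2"
    using euclidean_inner[of v v] sum_Basis[of "\<lambda>b. (v \<bullet> b) * (v \<bullet> b)"]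
    by (simp add: dot_square_norm power2_eq_square)
  finally show ?thesis
    using assms by (simp add: unit_sphere_def direction_def)
qed

lemma inner_comb: "i \<le> d \<Longrightarrow> comb \<beta> d x \<bullet> \<beta> i = x i"
proof -
  assume i: "i \<le> d"
  have "comb \<beta> d x \<bullet> \<beta> i = (\<Sum>j\<le>d. x j * (\<beta> j \<bullet> \<beta> i))"
    by (simp add: comb_def inner_sum_left)
  also have "\<dots> = (\<Sum>j\<le>d. if j = i then x j else 0)"
  proof (intro sum.cong refl)
    fix j assume j: "j \<in> {..d}"
    have "\<beta> j \<in> Basis" "\<beta> i \<in> Basis" "\<beta> j = \<beta> i \<longleftrightarrow> j = i"
      using bij i j by (auto simp: bij_betw_def inj_on_def)
    then show "x j * (\<beta> j \<bullet> \<beta> i) = (if j = i then x j else 0)"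
      by (simp add: inner_Basis)
  qed
  finally show ?thesis using i by simp
qed

lemma comb_inner: "comb \<beta> d (\<lambda>i. v \<bullet> \<beta> i) = v"
  unfolding comb_def using sum_Basis[of "\<lambda>b. (v \<bullet> b) *\<^sub>R b"] by (simp add: euclidean_representation)

lemma norm_comb:
  assumes "x \<in> unit_sphere d"
  shows "norm (comb \<beta> d x) = 1"
proof -
  have "(norm (comb \<beta> d x))\<^sup>2 = (\<Sum>i\<le>d. (x i)\<^sup>2)"
    using euclidean_inner[of "comb \<beta> d x" "comb \<beta> d x"]
      sum_Basis[of "\<lambda>b. (comb \<beta> d x \<bullet> b) * (comb \<beta> d x \<bullet> b)"]
    by (simp add: dot_square_norm power2_eq_square inner_comb)
  then have "(norm (comb \<beta> d x))\<^sup>2 = 1\<^sup>2" using assms by (simp add: unit_sphere_def)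
  then show ?thesis by (rule power2_eq_imp_eq) auto
qed

lemma comb_direction: "comb \<beta> d (direction \<beta> d v) = v /\<^sub>R norm v"
proof -
  have "comb \<beta> d (direction \<beta> d v) = comb \<beta> d (\<lambda>i. inverse (norm v) * (v \<bullet> \<beta> i))"
    unfolding comb_def 
    by (intro sum.cong refl) (simp add: direction_def divide_inverse mult.commute[of _ "inverse (norm v)"])
  also have "\<dots> = v /\<^sub>R norm v"
    by (subst comb_cmul) (simp add: comb_inner)
  finally show ?thesis .
qed

lemma direction_comb:
  assumes "x \<in> unit_sphere d"
  shows "direction \<beta> d (comb \<beta> d x) = x"
  using assms by (auto simp: direction_def norm_comb inner_comb fun_eq_iff unit_sphere_def)

lemma direction_scaleR: "r > 0 \<Longrightarrow> direction \<beta> d (r *\<^sub>R v) = direction \<beta> d v"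
  by (auto simp: direction_def fun_eq_iff)

lemma continuous_map_direction:
  assumes "continuous_on (unit_sphere d) \<phi>" "\<And>x. x \<in> unit_sphere d \<Longrightarrow> \<phi> x \<noteq> 0"
  shows "continuous_map (nsphere d) (nsphere d) (\<lambda>x. direction \<beta> d (\<phi> x))"
  unfolding continuous_map_nsphere_iff
  using continuous_on_direction[OF assms] assms(2) direction_in_sphere by blast

lemma sphere_degree_homotopy:
  assumes "continuous_on ({0..1::real} \<times> unit_sphere d) (\<lambda>(t, x). H t x)"
    and "\<And>t x. \<lbrakk>0 \<le> t; t \<le> 1; x \<in> unit_sphere d\<rbrakk> \<Longrightarrow> H t x \<noteq> 0"
  shows "sphere_degree \<beta> d (H 0) = sphere_degree \<beta> d (H 1)"
proof -
  have "homotopic_with_canon (\<lambda>x. True) (unit_sphere d) (unit_sphere d)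
          (\<lambda>x. direction \<beta> d (H 0 x)) (\<lambda>x. direction \<beta> d (H 1 x))"
    unfolding homotopic_with_def
  proof (intro exI conjI)
    have "continuous_on ({0..1} \<times> unit_sphere d) (\<lambda>z. direction \<beta> d (case z of (t, x) \<Rightarrow> H t x))"
      by (rule continuous_on_direction[OF assms(1)]) (use assms(2) in auto)
    then show "continuous_map (prod_topology (top_of_set {0..1}) (top_of_set (unit_sphere d)))
      (top_of_set (unit_sphere d)) (\<lambda>z. direction \<beta> d (case z of (t, x) \<Rightarrow> H t x))"
      using assms(2) by (auto simp: continuous_map_in_subtopology prod_topology_subtopology_eu intro!: direction_in_sphere)
  qed auto
  then show ?thesis
    unfolding sphere_degree_def
    by (intro Brouwer_degree2_homotopic) (simp add: nsphere_unit_sphere)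
qed

lemma sphere_degree_cong:
  "(\<And>x. x \<in> unit_sphere d \<Longrightarrow> \<phi> x = \<psi> x) \<Longrightarrow> sphere_degree \<beta> d \<phi> = sphere_degree \<beta> d \<psi>"
  unfolding sphere_degree_def
  by (rule Brouwer_degree2_eq) (simp add: nsphere_unit_sphere)

lemma sphere_degree_reflect:
  assumes "continuous_on (unit_sphere d) \<phi>" "\<And>x. x \<in> unit_sphere d \<Longrightarrow> \<phi> x \<noteq> 0" "k \<le> d"
  shows "sphere_degree \<beta> d (\<lambda>x. \<phi> (x(k := - x k))) = - sphere_degree \<beta> d \<phi>"
proof -
  have "continuous_map (nsphere d) (nsphere d) (\<lambda>x. x(k := - x k))"
    unfolding continuous_map_nsphere_iff by (auto intro: unit_sphere_reflect continuous_on_reflect)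
  from Brouwer_degree2_compose[OF this continuous_map_direction[OF assms(1,2)]] show ?thesis
    by (simp add: sphere_degree_def o_def degree_reflection[OF assms(3)])
qed

text \<open>A local inverse of \<open>g\<close> yields a map of spheres whose degree is inverse to that of \<open>g\<close>.\<close>

lemma abs_sphere_degree_injective:
  fixes g :: "'b \<Rightarrow> 'b"
  assumes cont: "continuous_on (cball 0 1) g" and inj: "inj_on g (cball 0 1)"
  shows "\<bar>sphere_degree \<beta> d (\<lambda>x. g (comb \<beta> d x) - g 0)\<bar> = 1"
proof -
  let ?B = "ball 0 1 :: 'b set"
  let ?S = "unit_sphere d"
  obtain k where k: "homeomorphism ?B (g ` ?B) g k"
    using invariance_of_domain_homeomorphism[of ?B g]
      continuous_on_subset[OF cont] inj_on_subset[OF inj] ball_subset_cball by blast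
  have kg: "k (g v) = v" if "v \<in> ?B" for v
    using k that by (auto simp: homeomorphism_def)
  have gk: "g (k w) = w" "k w \<in> ?B" if "w \<in> g ` ?B" for w
    using k that by (auto simp: homeomorphism_def)
  have contk: "continuous_on (g ` ?B) k"
    using k by (auto simp: homeomorphism_def)
  have "open (g ` ?B)"
    by (rule invariance_of_domain) (use continuous_on_subset[OF cont] inj_on_subset[OF inj] ball_subset_cball in blast)+
  moreover have "g 0 \<in> g ` ?B" by simp
  ultimately obtain s where s: "s > 0" "cball (g 0) s \<subseteq> g ` ?B"
    by (meson open_contains_cball)
  have "continuous_on ?B g"
    using continuous_on_subset[OF cont] ball_subset_cball by blast
  then have "isCont g 0"
    by (simp add: continuous_on_eq_continuous_at)
  then obtain \<delta> where \<delta>: "\<delta> > 0" "\<And>v. dist v 0 < \<delta> \<Longrightarrow> dist (g v) (g 0) < s"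
    using s(1) unfolding continuous_at_eps_delta by blast
  \<comment> \<open>\<open>r < \<delta>\<close> keeps the image of the small sphere within distance
    \<open>s\<close> of \<open>g 0\<close>, where \<open>k\<close> is defined;
    \<open>r \<le> 1/2\<close> keeps the sphere itself in the open ball.\<close>
  define r where "r = min (\<delta>/2) (1/2)"
  have r: "0 < r" "r < 1" "r < \<delta>"
    using \<delta>(1) by (auto simp: r_def)
  have eq0: "g v = g 0 \<longleftrightarrow> v = 0" if "v \<in> cball 0 1" for v
    using inj that by (auto simp: inj_on_def)
  have small: "dist (g (r *\<^sub>R comb \<beta> d x)) (g 0) < s" if "x \<in> ?S" for x
    by (rule \<delta>(2)) (use that r in \<open>simp add: norm_comb\<close>)
  have rB: "r *\<^sub>R comb \<beta> d x \<in> ?B" if "x \<in> ?S" for x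
    using that r by (simp add: norm_comb)
  have nz: "g (r *\<^sub>R comb \<beta> d x) - g 0 \<noteq> 0" if "x \<in> ?S" for x
    using that r norm_comb[OF that] eq0[of "r *\<^sub>R comb \<beta> d x"] by auto
  define F where "F = (\<lambda>x. direction \<beta> d (g (r *\<^sub>R comb \<beta> d x) - g 0))"
  define G where "G = (\<lambda>y. direction \<beta> d (k (g 0 + s *\<^sub>R comb \<beta> d y)))"
  have contF: "continuous_map (nsphere d) (nsphere d) F"
    unfolding F_def
  proof (rule continuous_map_direction[OF _ nz])
    have "continuous_on ?S (\<lambda>x. g (r *\<^sub>R comb \<beta> d x))"
      by (intro continuous_on_compose2[OF cont] continuous_on_scaleR continuous_on_comb
          continuous_on_const continuous_on_id) (use rB in force)
    then show "continuous_on ?S (\<lambda>x. g (r *\<^sub>R comb \<beta> d x) - g 0)"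
      by (intro continuous_on_diff continuous_on_const)
  qed
  have k0: "k w \<noteq> 0" if "w \<in> g ` ?B" "w \<noteq> g 0" for w
    using gk(1)[OF that(1)] that(2) by auto
  have inV: "g 0 + t *\<^sub>R (comb \<beta> d y) \<in> g ` ?B" if "y \<in> ?S" "0 \<le> t" "t \<le> s" for y t
    using s(2) that norm_comb[OF that(1)] by (auto simp: subset_iff dist_norm)
  have contG: "continuous_map (nsphere d) (nsphere d) G"
    unfolding G_def
  proof (rule continuous_map_direction)
    show "continuous_on ?S (\<lambda>y. k (g 0 + s *\<^sub>R comb \<beta> d y))"
      by (intro continuous_on_compose2[OF contk] continuous_on_add continuous_on_scaleR continuous_on_comb
          continuous_on_const continuous_on_id) (use inV s in force)
    show "k (g 0 + s *\<^sub>R comb \<beta> d y) \<noteq> 0" if "y \<in> ?S" for y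
      using inV[OF that, of s] s norm_comb[OF that] by (intro k0) auto
  qed
  \<comment> \<open>\<open>H\<close> slides a point along its ray from \<open>g 0\<close>: at
    \<open>t = 0\<close> to distance \<open>s\<close>, which gives \<open>G \<circ> F\<close> after
    projection, and at \<open>t = 1\<close> to its own place, where \<open>k\<close> undoes
    \<open>g\<close>. The path stays in the ball of radius \<open>s\<close> and never reaches
    \<open>g 0\<close>, so \<open>k\<close> has no zero on it.\<close>
  define \<mu> where "\<mu> = (\<lambda>t x. (1 - t) * (s / norm (g (r *\<^sub>R comb \<beta> d x) - g 0)) + t)"
  define H where "H = (\<lambda>t x. k (g 0 + \<mu> t x *\<^sub>R (g (r *\<^sub>R comb \<beta> d x) - g 0)))"
  have dirs: "g 0 + \<mu> t x *\<^sub>R (g (r *\<^sub>R comb \<beta> d x) - g 0) \<in> g ` ?B"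
    and dirs0: "\<mu> t x > 0" if "x \<in> ?S" "0 \<le> t" "t \<le> 1" for t x
  proof -
    let ?n = "norm (g (r *\<^sub>R comb \<beta> d x) - g 0)"
    have n: "0 < ?n" "?n < s"
      using nz[OF that(1)] small[OF that(1)] by (auto simp: dist_norm)
    have "\<mu> t x * ?n = (1 - t) * s + t * ?n"
      using n by (simp add: \<mu>_def field_simps)
    also have "\<dots> \<le> (1 - t) * s + t * s"
      using n that by (intro add_left_mono mult_left_mono) auto
    finally have le: "\<mu> t x * ?n \<le> s" by (simp add: algebra_simps)
    show pos: "\<mu> t x > 0"
      unfolding \<mu>_def using n that s
      by (cases "t = 0") (auto intro!: add_nonneg_pos mult_nonneg_nonneg)
    show "g 0 + \<mu> t x *\<^sub>R (g (r *\<^sub>R comb \<beta> d x) - g 0) \<in> g ` ?B"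
      by (rule subsetD[OF s(2)]) (use le pos in \<open>simp add: dist_norm\<close>)
  qed
  have "sphere_degree \<beta> d (H 0) = sphere_degree \<beta> d (H 1)"
  proof (rule sphere_degree_homotopy)
    have "continuous_on ({0..1} \<times> ?S) (\<lambda>z. g (r *\<^sub>R comb \<beta> d (snd z)))"
      by (intro continuous_on_compose2[OF cont] continuous_on_scaleR continuous_on_comb
          continuous_on_const continuous_on_snd continuous_on_id) (use rB in force)
    then have "continuous_on ({0..1} \<times> ?S)
       (\<lambda>z. k (g 0 + \<mu> (fst z) (snd z) *\<^sub>R (g (r *\<^sub>R comb \<beta> d (snd z)) - g 0)))"
      unfolding \<mu>_def
      apply (intro continuous_on_compose2[OF contk] continuous_intros)
      using nz dirs by (auto simp: \<mu>_def)
    then show "continuous_on ({0..1} \<times> ?S) (\<lambda>(t, x). H t x)"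
      by (simp add: H_def case_prod_unfold)
    show "H t x \<noteq> 0" if "0 \<le> t" "t \<le> 1" "x \<in> ?S" for t x
      unfolding H_def using dirs[of x t] dirs0[of x t] that nz[of x]
      by (intro k0) auto
  qed
  moreover have "sphere_degree \<beta> d (H 1) = sphere_degree \<beta> d (comb \<beta> d)"
  proof -
    have "sphere_degree \<beta> d (H 1) = Brouwer_degree2 d (\<lambda>x. direction \<beta> d (r *\<^sub>R comb \<beta> d x))"
      unfolding sphere_degree_def
      by (rule Brouwer_degree2_eq) (use kg rB in \<open>auto simp: nsphere_unit_sphere H_def \<mu>_def\<close>)
    then show ?thesis
      by (simp add: sphere_degree_def direction_scaleR r(1))
  qed
  moreover have "sphere_degree \<beta> d (comb \<beta> d) = 1"
    unfolding sphere_degree_def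
    using Brouwer_degree2_eq[of d "\<lambda>x. direction \<beta> d (comb \<beta> d x)" id] 
    by (simp add: nsphere_unit_sphere direction_comb)
  moreover have "sphere_degree \<beta> d (H 0) = Brouwer_degree2 d (G \<circ> F)"
    unfolding sphere_degree_def H_def G_def F_def \<mu>_def
    by (simp add: o_def comb_direction divide_inverse)
  ultimately have "Brouwer_degree2 d G * Brouwer_degree2 d F = 1"
    using Brouwer_degree2_compose[OF contF contG] by simp
  then have "\<bar>Brouwer_degree2 d F\<bar> = 1"
    by (metis mult.commute zmult_eq_1_iff abs_1 abs_minus)
  moreover have "sphere_degree \<beta> d (\<lambda>x. g (comb \<beta> d x) - g 0) = Brouwer_degree2 d F"
  proof -
    \<comment> \<open>The radius shrinks linearly from 1 to \<open>r\<close>; injectivity on the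
      whole closed ball keeps the difference nonzero.\<close>
    let ?\<rho> = "\<lambda>t. 1 - t + t * r"
    have \<rho>: "0 < ?\<rho> t" "?\<rho> t \<le> 1" if "0 \<le> t" "t \<le> 1" for t
    proof -
      show "0 < ?\<rho> t" using that r by (cases "t = 1") (auto intro: add_pos_nonneg)
      show "?\<rho> t \<le> 1" using that r by (simp add: mult_left_le)
    qed
    have in1: "?\<rho> t *\<^sub>R comb \<beta> d x \<in> cball 0 1" if "0 \<le> t" "t \<le> 1" "x \<in> ?S" for t x
      using \<rho>[OF that(1,2)] norm_comb[OF that(3)] by simp
    have "sphere_degree \<beta> d (\<lambda>x. g (?\<rho> 0 *\<^sub>R comb \<beta> d x) - g 0) =
          sphere_degree \<beta> d (\<lambda>x. g (?\<rho> 1 *\<^sub>R comb \<beta> d x) - g 0)"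
    proof (rule sphere_degree_homotopy)
      have "continuous_on ({0..1} \<times> ?S) (\<lambda>z. g (?\<rho> (fst z) *\<^sub>R comb \<beta> d (snd z)))"
      proof (rule continuous_on_compose2[OF cont])
        show "continuous_on ({0..1} \<times> ?S) (\<lambda>z. ?\<rho> (fst z) *\<^sub>R comb \<beta> d (snd z))"
          by (intro continuous_intros)
        show "(\<lambda>z. ?\<rho> (fst z) *\<^sub>R comb \<beta> d (snd z)) ` ({0..1} \<times> ?S) \<subseteq> cball 0 1"
          using in1 by (simp add: image_subset_iff)
      qed
      then have "continuous_on ({0..1} \<times> ?S) (\<lambda>z. g (?\<rho> (fst z) *\<^sub>R comb \<beta> d (snd z)) - g 0)"
        by (intro continuous_on_diff continuous_on_const)
      then show "continuous_on ({0..1} \<times> ?S) (\<lambda>(t, x). g (?\<rho> t *\<^sub>R comb \<beta> d x) - g 0)"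
        by (simp add: case_prod_unfold)
      show "g (?\<rho> t *\<^sub>R comb \<beta> d x) - g 0 \<noteq> 0" if "0 \<le> t" "t \<le> 1" "x \<in> ?S" for t x
        using eq0[OF in1[OF that]] \<rho>(1)[OF that(1,2)] norm_comb[OF that(3)] by auto
    qed
    then show ?thesis by (simp add: sphere_degree_def F_def)
  qed
  ultimately show ?thesis by simp
qed

end

subsection \<open>The local degree of an embedding on a simplex\<close>

lemma comb_add: "comb b d (\<lambda>i. x i + y i) = comb b d x + comb b d y"
  by (simp add: comb_def scaleR_add_left sum.distrib)

lemma comb_cong: "(\<And>i. i \<le> d \<Longrightarrow> x i *\<^sub>R b i = y i *\<^sub>R c i) \<Longrightarrow> comb b d x = comb c d y"
  unfolding comb_def by (rule sum.cong) auto

text \<open>Affine independence of an indexed family rather than of a set: this includes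
  injectivity, and the degree depends on the order of the vertices.\<close>

definition simplex_vertices :: "nat \<Rightarrow> (nat \<Rightarrow> 'a::real_vector) \<Rightarrow> bool" where
  "simplex_vertices n u \<longleftrightarrow>
     (\<forall>c. (\<Sum>i\<le>n. c i) = 0 \<and> (\<Sum>i\<le>n. c i *\<^sub>R u i) = 0 \<longrightarrow> (\<forall>i\<le>n. c i = 0))"

lemma simplex_verticesI:
  assumes "inj_on u {..n}" "\<not> affine_dependent (u ` {..n})"
  shows "simplex_vertices n u"
  unfolding simplex_vertices_def
proof (intro allI impI)
  fix c :: "nat \<Rightarrow> real" and i
  assume c: "(\<Sum>i\<le>n. c i) = 0 \<and> (\<Sum>i\<le>n. c i *\<^sub>R u i) = 0" and i: "i \<le> n"
  define v where "v = inv_into {..n} u"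
  have v: "v (u j) = j" if "j \<le> n" for j
    using assms(1) that by (simp add: v_def)
  have "sum (c \<circ> v) (u ` {..n}) = 0" "(\<Sum>x\<in>u ` {..n}. (c \<circ> v) x *\<^sub>R x) = 0"
    using c by (simp_all add: sum.reindex[OF assms(1)] v)
  then have "\<forall>x\<in>u ` {..n}. (c \<circ> v) x = 0"
    using assms(2) unfolding affine_dependent_explicit_finite[OF finite_imageI[OF finite_atMost]] by blast
  then show "c i = 0"
    using i by (simp add: v)
qed

lemma simplex_vertices_inj_on:
  assumes "simplex_vertices n u"
  shows "inj_on u {..n}"
proof (rule inj_onI, rule ccontr)
  fix i j assume ij: "i \<in> {..n}" "j \<in> {..n}" "u i = u j" "i \<noteq> j"
  define c :: "nat \<Rightarrow> real" where "c = (\<lambda>k. (if k = i then 1 else 0) - (if k = j then 1 else 0))"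
  have "(\<Sum>k\<le>n. c k) = 0" "(\<Sum>k\<le>n. c k *\<^sub>R u k) = 0"
    using ij by (auto simp: c_def sum_subtractf scaleR_diff_left if_distrib[of "\<lambda>r. r *\<^sub>R _"] cong: if_cong)
  then have "c i = 0"
    using assms ij(1) by (auto simp: simplex_vertices_def)
  then show False using ij(4) by (simp add: c_def)
qed

lemma simplex_vertices_permute:
  assumes "p permutes {..n}" "simplex_vertices n u"
  shows "simplex_vertices n (u \<circ> p)"
  unfolding simplex_vertices_def
proof (intro allI impI)
  fix c :: "nat \<Rightarrow> real" and i
  assume c: "(\<Sum>i\<le>n. c i) = 0 \<and> (\<Sum>i\<le>n. c i *\<^sub>R (u \<circ> p) i) = 0" and i: "i \<le> n"
  have p: "inv_into UNIV p (p j) = j" for j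
    using assms(1) by (simp add: permutes_inverses)
  have "(\<Sum>i\<le>n. (c \<circ> inv_into UNIV p) i) = 0" "(\<Sum>i\<le>n. (c \<circ> inv_into UNIV p) i *\<^sub>R u i) = 0"
    using c sum.permute[OF assms(1), of "c \<circ> inv_into UNIV p"] sum.permute[OF assms(1), of "\<lambda>i. (c \<circ> inv_into UNIV p) i *\<^sub>R u i"]
    by (simp_all add: o_def p)
  then have "\<forall>i\<le>n. (c \<circ> inv_into UNIV p) i = 0"
    using assms(2) by (auto simp: simplex_vertices_def)
  then show "c i = 0"
    using i permutes_in_image[OF assms(1), of i] by (metis atMost_iff comp_apply p)
qed

lemma convex_hull_image_memI:
  assumes "finite I" "\<And>i. i \<in> I \<Longrightarrow> 0 \<le> c i" "sum c I = 1"
  shows "(\<Sum>i\<in>I. c i *\<^sub>R u i) \<in> convex hull (u ` I)"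
  by (rule convex_sum[OF assms(1) convex_convex_hull assms(3)]) (auto intro: assms(2) hull_inc)

text \<open>The barycentric coordinates of the vector \<open>\<Sum>i\<le>d. x i *\<^sub>R (u i - u (Suc d))\<close>.\<close>

definition balance :: "nat \<Rightarrow> (nat \<Rightarrow> real) \<Rightarrow> nat \<Rightarrow> real" where
  "balance d x i = (if i \<le> d then x i else - (\<Sum>j\<le>d. x j))"

text \<open>The base is the last vertex, so that the others are numbered like the coordinates of
  \<open>unit_sphere d\<close>, and replacing vertex 0 alters edge 0 only.\<close>

definition edges :: "nat \<Rightarrow> (nat \<Rightarrow> 'a::real_vector) \<Rightarrow> nat \<Rightarrow> 'a" where
  "edges d u i = u i - u (Suc d)"

lemma sum_balance: "(\<Sum>i\<le>Suc d. balance d x i) = 0"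
  by (simp add: balance_def)

lemma comb_edges: "comb (edges d u) d x = (\<Sum>i\<le>Suc d. balance d x i *\<^sub>R u i)"
  by (simp add: comb_def edges_def balance_def scaleR_diff_right sum_subtractf scaleR_sum_left)

lemma comb_edges_eq_0D:
  assumes "simplex_vertices (Suc d) u" "comb (edges d u) d x = 0" "i \<le> d"
  shows "x i = 0"
proof -
  have "balance d x i = 0"
    using assms sum_balance[of d x] unfolding simplex_vertices_def comb_edges
    by (metis le_SucI)
  then show ?thesis using assms(3) by (simp add: balance_def)
qed

lemma abs_balance_le:
  assumes "\<And>i. i \<le> d \<Longrightarrow> \<bar>x i\<bar> \<le> r" 
  shows "\<bar>balance d x i\<bar> \<le> (d + 1) * r"
proof (cases "i \<le> d")
  case True
  have "0 \<le> r" using assms[of 0] by simp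
  then have "r \<le> (d + 1) * r" by (simp add: algebra_simps)
  then show ?thesis using assms[OF True] True by (simp add: balance_def add.commute)
next
  case False
  have "\<bar>\<Sum>j\<le>d. x j\<bar> \<le> (\<Sum>j\<le>d. r)"
    by (rule order_trans[OF sum_abs]) (rule sum_mono, simp add: assms)
  then show ?thesis using False by (simp add: balance_def algebra_simps)
qed

definition barycenter :: "nat \<Rightarrow> (nat \<Rightarrow> 'a::real_vector) \<Rightarrow> 'a" where
  "barycenter d u = (\<Sum>i\<le>Suc d. (1 / (real d + 2)) *\<^sub>R u i)"

text \<open>If all \<open>\<bar>x i\<bar> \<le> 1\<close>, each barycentric coordinate moves by at
  most \<open>(d + 1) / (d + 2)\<^sup>2\<close>, which is less than its value
  \<open>1 / (d + 2)\<close> at the barycenter. So the image of the unit sphere stays in the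
  simplex.\<close>

definition simplex_frame :: "nat \<Rightarrow> (nat \<Rightarrow> 'a::real_vector) \<Rightarrow> nat \<Rightarrow> 'a" where
  "simplex_frame d u i = (1 / (real d + 2)\<^sup>2) *\<^sub>R edges d u i"

lemma comb_simplex_frame: "comb (simplex_frame d u) d x = (1 / (real d + 2)\<^sup>2) *\<^sub>R comb (edges d u) d x"
  unfolding simplex_frame_def by (rule comb_scaleR)

lemma barycenter_comb_in_hull:
  assumes "\<And>i. i \<le> d \<Longrightarrow> \<bar>x i\<bar> \<le> 1"
  shows "barycenter d u + comb (simplex_frame d u) d x \<in> convex hull (u ` {..Suc d})"
proof -
  let ?c = "\<lambda>i. 1 / (real d + 2) + (1 / (real d + 2)\<^sup>2) * balance d x i"
  have eq: "barycenter d u + comb (simplex_frame d u) d x = (\<Sum>i\<le>Suc d. ?c i *\<^sub>R u i)"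
    unfolding comb_simplex_frame comb_edges barycenter_def scaleR_sum_right
    by (simp only: scaleR_add_left scaleR_scaleR sum.distrib)
  have "0 \<le> ?c i" for i
  proof -
    have "\<bar>balance d x i\<bar> \<le> d + 1"
      using abs_balance_le[of d x 1 i] assms by simp
    then have "0 \<le> (real d + 2) + balance d x i" by simp
    then have "0 \<le> (1 / (real d + 2)\<^sup>2) * ((real d + 2) + balance d x i)"
      by (intro mult_nonneg_nonneg) auto
    also have "1 / D\<^sup>2 * (D + e) = 1 / D + 1 / D\<^sup>2 * e" if "D > 0" for D e :: real
      using that by (simp add: field_simps power2_eq_square)
    then have "(1 / (real d + 2)\<^sup>2) * ((real d + 2) + balance d x i) = ?c i"
      by simp
    finally show ?thesis .
  qed
  moreover have "(\<Sum>i\<le>Suc d. ?c i) = 1"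
    by (simp only: sum.distrib sum_balance flip: sum_distrib_left) simp
  ultimately show ?thesis
    unfolding eq by (intro convex_hull_image_memI) auto
qed

lemma comb_zero [simp]: "comb b d (\<lambda>i. 0) = 0"
  by (simp add: comb_def)

lemma barycenter_in_hull: "barycenter d u \<in> convex hull (u ` {..Suc d})"
  using barycenter_comb_in_hull[of d "\<lambda>i. 0" u] by simp

context orthonormal_frame
begin

definition local_degree :: "('a::euclidean_space \<Rightarrow> 'b) \<Rightarrow> 'a \<Rightarrow> (nat \<Rightarrow> 'a) \<Rightarrow> int" where
  "local_degree f p b = sphere_degree \<beta> d (\<lambda>x. f (p + comb b d x) - f p)"

text \<open>Centre and frame are interpolated linearly. Convexity of \<open>M\<close> keeps every
  point in the domain, and injectivity of \<open>f\<close> on \<open>M\<close> reduces nonvanishing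
  to the nondegeneracy \<open>nz\<close> of the interpolated frame.\<close>

lemma local_degree_homotopy:
  fixes f :: "'a::euclidean_space \<Rightarrow> 'b"
  assumes M: "convex M" "continuous_on M f" "inj_on f M"
    and p: "p \<in> M" "\<And>x. x \<in> unit_sphere d \<Longrightarrow> p + comb b d x \<in> M"
    and p': "p' \<in> M" "\<And>x. x \<in> unit_sphere d \<Longrightarrow> p' + comb b' d x \<in> M"
    and nz: "\<And>t x. \<lbrakk>0 \<le> t; t \<le> 1; x \<in> unit_sphere d\<rbrakk> \<Longrightarrow> comb (\<lambda>i. (1 - t) *\<^sub>R b i + t *\<^sub>R b' i) d x \<noteq> 0"
  shows "local_degree f p b = local_degree f p' b'"
proof -
  let ?S = "unit_sphere d"
  define P where "P = (\<lambda>t. (1 - t) *\<^sub>R p + t *\<^sub>R p')"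
  define B where "B = (\<lambda>t i. (1 - t) *\<^sub>R b i + t *\<^sub>R b' i)"
  have comb_B: "comb (B t) d x = (1 - t) *\<^sub>R comb b d x + t *\<^sub>R comb b' d x" for t x
    by (simp add: comb_def B_def scaleR_add_right sum.distrib scaleR_sum_right mult.commute)
  have inM: "P t + comb (B t) d x \<in> M" if "0 \<le> t" "t \<le> 1" "x \<in> ?S" for t x
  proof -
    have "P t + comb (B t) d x = (1 - t) *\<^sub>R (p + comb b d x) + t *\<^sub>R (p' + comb b' d x)"
      by (simp add: P_def comb_B algebra_simps)
    then show ?thesis
      using convexD[OF M(1) p(2)[OF that(3)] p'(2)[OF that(3)], of "1 - t" t] that by simp
  qed
  have PM: "P t \<in> M" if "0 \<le> t" "t \<le> 1" for t
    unfolding P_def using convexD[OF M(1) p(1) p'(1), of "1 - t" t] that by simp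
  have "sphere_degree \<beta> d (\<lambda>x. f (P 0 + comb (B 0) d x) - f (P 0)) =
        sphere_degree \<beta> d (\<lambda>x. f (P 1 + comb (B 1) d x) - f (P 1))"
  proof (rule sphere_degree_homotopy)
    have "continuous_on ({0..1} \<times> ?S) (\<lambda>z. f (P (fst z) + comb (B (fst z)) d (snd z)))"
    proof (rule continuous_on_compose2[OF M(2)])
      show "continuous_on ({0..1} \<times> ?S) (\<lambda>z. P (fst z) + comb (B (fst z)) d (snd z))"
        unfolding P_def B_def by (intro continuous_intros)
      show "(\<lambda>z. P (fst z) + comb (B (fst z)) d (snd z)) ` ({0..1} \<times> ?S) \<subseteq> M"
        using inM by auto
    qed
    moreover have "continuous_on ({0..1} \<times> ?S) (\<lambda>z. f (P (fst z)))"
    proof (rule continuous_on_compose2[OF M(2)])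
      show "continuous_on ({0..1} \<times> ?S) (\<lambda>z. P (fst z))"
        unfolding P_def by (intro continuous_intros)
      show "(\<lambda>z. P (fst z)) ` ({0..1} \<times> ?S) \<subseteq> M"
        using PM by auto
    qed
    ultimately have "continuous_on ({0..1} \<times> ?S)
        (\<lambda>z. f (P (fst z) + comb (B (fst z)) d (snd z)) - f (P (fst z)))"
      by (rule continuous_on_diff)
    then show "continuous_on ({0..1} \<times> ?S) (\<lambda>(t, x). f (P t + comb (B t) d x) - f (P t))"
      by (simp add: case_prod_unfold)
    show "f (P t + comb (B t) d x) - f (P t) \<noteq> 0" if "0 \<le> t" "t \<le> 1" "x \<in> ?S" for t x
    proof
      assume "f (P t + comb (B t) d x) - f (P t) = 0"
      then have "P t + comb (B t) d x = P t"
        by (intro inj_onD[OF M(3) _ inM[OF that] PM[OF that(1,2)]]) simp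
      then show False using nz[OF that] by (simp add: B_def)
    qed
  qed
  then show ?thesis by (simp add: local_degree_def P_def B_def)
qed

definition simplex_degree :: "('a::euclidean_space \<Rightarrow> 'b) \<Rightarrow> (nat \<Rightarrow> 'a) \<Rightarrow> int" where
  "simplex_degree f u = local_degree f (barycenter d u) (simplex_frame d u)"

lemma simplex_degree_cong:
  assumes "\<And>i. i \<le> Suc d \<Longrightarrow> u i = v i"
  shows "simplex_degree f u = simplex_degree f v"
proof -
  have "barycenter d u = barycenter d v"
    unfolding barycenter_def by (rule sum.cong) (auto simp: assms)
  moreover have "comb (simplex_frame d u) d x = comb (simplex_frame d v) d x" for x
    by (rule comb_cong) (simp add: simplex_frame_def edges_def assms)
  ultimately show ?thesis
    by (simp add: simplex_degree_def local_degree_def)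
qed

text \<open>The affine chart \<open>A\<close> maps the unit ball of the target space into the
  simplex. So \<open>f \<circ> A\<close> is a continuous injection of that ball into its own space,
  the situation of \<open>abs_sphere_degree_injective\<close>.\<close>

lemma abs_simplex_degree:
  fixes f :: "'a::euclidean_space \<Rightarrow> 'b"
  assumes u: "simplex_vertices (Suc d) u"
    and cont: "continuous_on (convex hull (u ` {..Suc d})) f" and inj: "inj_on f (convex hull (u ` {..Suc d}))"
  shows "\<bar>simplex_degree f u\<bar> = 1"
proof -
  define A where "A = (\<lambda>v. barycenter d u + comb (simplex_frame d u) d (\<lambda>i. v \<bullet> \<beta> i))"
  have A_in: "A v \<in> convex hull (u ` {..Suc d})" if "v \<in> cball 0 1" for v
    unfolding A_def
  proof (rule barycenter_comb_in_hull)
    fix i assume "i \<le> d"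
    then have "\<beta> i \<in> Basis" using bij by (auto simp: bij_betw_def)
    then show "\<bar>v \<bullet> \<beta> i\<bar> \<le> 1"
      using Basis_le_norm[of "\<beta> i" v] that by simp
  qed
  have "inj A"
  proof
    fix v w assume "A v = A w"
    then have "comb (edges d u) d (\<lambda>i. v \<bullet> \<beta> i) = comb (edges d u) d (\<lambda>i. w \<bullet> \<beta> i)"
      by (simp add: A_def comb_simplex_frame)
    then have "comb (edges d u) d (\<lambda>i. (v - w) \<bullet> \<beta> i) = 0"
      by (simp add: comb_def inner_diff_left scaleR_diff_left sum_subtractf)
    then have "(v - w) \<bullet> \<beta> i = 0" if "i \<le> d" for i
      using comb_edges_eq_0D[OF u] that by blast
    then have "(v - w) \<bullet> c = 0" if "c \<in> Basis" for c
      using that bij by (metis atMost_iff bij_betw_def imageE)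
    then show "v = w" by (metis euclidean_eqI inner_diff_left eq_iff_diff_eq_0)
  qed
  have "continuous_on (cball 0 1) (f \<circ> A)"
  proof (rule continuous_on_compose[OF _ continuous_on_subset[OF cont]])
    show "continuous_on (cball 0 1) A"
      unfolding A_def comb_def by (intro continuous_intros)
  qed (use A_in in auto)
  moreover have "inj_on (f \<circ> A) (cball 0 1)"
  proof (rule comp_inj_on)
    show "inj_on A (cball 0 1)"
      using \<open>inj A\<close> inj_on_subset by blast
    show "inj_on f (A ` cball 0 1)"
      by (rule inj_on_subset[OF inj]) (use A_in in blast)
  qed
  ultimately have "\<bar>sphere_degree \<beta> d (\<lambda>x. (f \<circ> A) (comb \<beta> d x) - (f \<circ> A) 0)\<bar> = 1"
    by (rule abs_sphere_degree_injective)
  moreover have "A (comb \<beta> d x) = barycenter d u + comb (simplex_frame d u) d x" for x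
    unfolding A_def by (intro arg_cong2[of _ _ _ _ "(+)"] comb_cong refl) (simp add: inner_comb)
  moreover have "A 0 = barycenter d u"
    by (simp add: A_def)
  ultimately show ?thesis
    by (simp add: simplex_degree_def local_degree_def)
qed

lemma local_degree_reflect:
  fixes f :: "'a::euclidean_space \<Rightarrow> 'b"
  assumes "continuous_on M f" "inj_on f M" "p \<in> M"
    and b: "\<And>x. x \<in> unit_sphere d \<Longrightarrow> p + comb b d x \<in> M" "\<And>x. x \<in> unit_sphere d \<Longrightarrow> comb b d x \<noteq> 0"
    and "k \<le> d"
  shows "local_degree f p (b(k := - b k)) = - local_degree f p b"
proof -
  have "sphere_degree \<beta> d (\<lambda>x. f (p + comb b d (x(k := - x k))) - f p) = - local_degree f p b"
    unfolding local_degree_def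
  proof (rule sphere_degree_reflect[OF _ _ \<open>k \<le> d\<close>])
    have "continuous_on (unit_sphere d) (\<lambda>x. f (p + comb b d x))"
    proof (rule continuous_on_compose2[OF assms(1)])
      show "continuous_on (unit_sphere d) (\<lambda>x. p + comb b d x)"
        by (intro continuous_intros)
    qed (use b in auto)
    then show "continuous_on (unit_sphere d) (\<lambda>x. f (p + comb b d x) - f p)"
      by (intro continuous_intros)
    show "f (p + comb b d x) - f p \<noteq> 0" if "x \<in> unit_sphere d" for x
      using inj_onD[OF assms(2), of "p + comb b d x" p] b[OF that] assms(3) by auto
  qed
  then show ?thesis
    by (simp add: local_degree_def comb_reflect)
qed

lemma unit_sphere_eq_0D: "x \<in> unit_sphere d \<Longrightarrow> \<not> (\<forall>i\<le>d. x i = 0)"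
  using unit_sphere_nonzero by blast

text \<open>Exchanging the vertex \<open>u k\<close> with the base point \<open>u (Suc d)\<close> of the frame reflects the \<open>k\<close>-th
  edge and shears the others along it.\<close>

lemma simplex_degree_swap_base:
  fixes f :: "'a::euclidean_space \<Rightarrow> 'b"
  assumes u: "simplex_vertices (Suc d) u"
    and cont: "continuous_on (convex hull (u ` {..Suc d})) f" and inj: "inj_on f (convex hull (u ` {..Suc d}))"
    and k: "k \<le> d"
  shows "simplex_degree f (u \<circ> Transposition.transpose k (Suc d)) = - simplex_degree f u"
proof -
  let ?M = "convex hull (u ` {..Suc d})"
  define u' where "u' = u \<circ> Transposition.transpose k (Suc d)"
  have perm: "Transposition.transpose k (Suc d) permutes {..Suc d}"
    using k by (intro permutes_swap_id) auto
  have im: "u' ` {..Suc d} = u ` {..Suc d}"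
    by (simp only: u'_def image_comp[symmetric] permutes_image[OF perm])
  have q: "barycenter d u' = barycenter d u"
    unfolding barycenter_def u'_def
    using sum.permute[OF perm, of "\<lambda>i. (1 / (real d + 2)) *\<^sub>R u i"] by (simp add: o_def)
  define b where "b = simplex_frame d u"
  define b' where "b' = simplex_frame d u'"
  have b': "b' i = (if i = k then - b k else b i - b k)" if "i \<le> d" for i
    using that k by (auto simp: b'_def b_def simplex_frame_def edges_def u'_def
        scaleR_diff_right Transposition.transpose_def)
  have bM: "barycenter d u + comb b d x \<in> ?M" if "x \<in> unit_sphere d" for x
    unfolding b_def by (rule barycenter_comb_in_hull) (use unit_sphere_abs_le[OF that] in auto)
  have b0: "\<forall>i\<le>d. x i = 0" if "comb b d x = 0" for x
    using comb_edges_eq_0D[OF u] that by (auto simp: b_def comb_simplex_frame)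
  have "local_degree f (barycenter d u) b' = local_degree f (barycenter d u) (b(k := - b k))"
  proof (rule local_degree_homotopy[OF convex_convex_hull cont inj barycenter_in_hull _ barycenter_in_hull])
    fix x assume x: "x \<in> unit_sphere d"
    show "barycenter d u + comb b' d x \<in> ?M"
      using barycenter_comb_in_hull[of d x u'] unit_sphere_abs_le[OF x] by (simp add: b'_def q im)
    show "barycenter d u + comb (b(k := - b k)) d x \<in> ?M"
      using bM[OF unit_sphere_reflect[OF x, of k]] by (simp add: comb_reflect)
    fix t :: real assume "0 \<le> t" "t \<le> 1"
    define s where "s = (\<Sum>i\<in>{..d}-{k}. x i)"
    \<comment> \<open>Expressed in \<open>b\<close>, the interpolated frame sends \<open>x\<close>
      to \<open>comb b d y\<close>: coordinate \<open>k\<close> is negated and sheared by the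
      others, which do not change. This substitution is triangular with diagonal entries 1 and -1,
      so \<open>y = 0\<close> forces \<open>x = 0\<close> at every \<open>t\<close>.\<close>
    define y where "y = (\<lambda>i. if i = k then - x k - (1 - t) * s else x i)"
    have "comb (\<lambda>i. (1 - t) *\<^sub>R b' i + t *\<^sub>R (b(k := - b k)) i) d x =
          comb (\<lambda>i. if i = k then - b k else b i - (1 - t) *\<^sub>R b k) d x"
      by (rule comb_cong) (auto simp: b' algebra_simps)
    also have "\<dots> = x k *\<^sub>R (- b k) + (\<Sum>i\<in>{..d}-{k}. x i *\<^sub>R (b i - (1 - t) *\<^sub>R b k))"
      unfolding comb_def using k by (subst sum.remove[of _ k]) auto
    also have "(\<Sum>i\<in>{..d}-{k}. x i *\<^sub>R (b i - (1 - t) *\<^sub>R b k)) =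
        (\<Sum>i\<in>{..d}-{k}. x i *\<^sub>R b i) - ((1 - t) * s) *\<^sub>R b k"
      by (simp only: s_def scaleR_diff_right sum_subtractf scaleR_scaleR scaleR_sum_left sum_distrib_left mult.commute)
    also have "(\<Sum>i\<in>{..d}-{k}. x i *\<^sub>R b i) = (\<Sum>i\<in>{..d}-{k}. y i *\<^sub>R b i)"
      by (rule sum.cong) (auto simp: y_def)
    also have "x k *\<^sub>R - b k + ((\<Sum>i\<in>{..d}-{k}. y i *\<^sub>R b i) - ((1 - t) * s) *\<^sub>R b k) =
        y k *\<^sub>R b k + (\<Sum>i\<in>{..d}-{k}. y i *\<^sub>R b i)"
      by (simp add: y_def algebra_simps)
    also have "\<dots> = comb b d y"
      unfolding comb_def using k by (subst (2) sum.remove[of _ k]) auto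
    finally have eq: "comb (\<lambda>i. (1 - t) *\<^sub>R b' i + t *\<^sub>R (b(k := - b k)) i) d x = comb b d y" .
    show "comb (\<lambda>i. (1 - t) *\<^sub>R b' i + t *\<^sub>R (b(k := - b k)) i) d x \<noteq> 0"
    proof
      assume "comb (\<lambda>i. (1 - t) *\<^sub>R b' i + t *\<^sub>R (b(k := - b k)) i) d x = 0"
      then have y: "\<forall>i\<le>d. y i = 0" using b0 eq by simp
      then have *: "x i = 0" if "i \<le> d" "i \<noteq> k" for i
        using that by (metis y_def)
      then have "s = 0" unfolding s_def by (intro sum.neutral) auto
      then have "x k = 0" using y k by (auto simp: y_def)
      then show False using * unit_sphere_eq_0D[OF x] by metis
    qed
  qed
  also have "\<dots> = - local_degree f (barycenter d u) b"
  proof (rule local_degree_reflect[OF cont inj barycenter_in_hull bM _ k])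
    show "comb b d x \<noteq> 0" if "x \<in> unit_sphere d" for x
      using b0 unit_sphere_eq_0D[OF that] by blast
  qed
  finally show ?thesis
    by (simp add: simplex_degree_def b_def b'_def q flip: u'_def)
qed

text \<open>Away from the base vertex \<open>n = Suc d\<close>, the transposition factors as
  \<open>(i n) (j n) (i n)\<close>, and each of the three exchanges with the base changes the
  sign.\<close>

lemma simplex_degree_transpose:
  fixes f :: "'a::euclidean_space \<Rightarrow> 'b"
  assumes u: "simplex_vertices (Suc d) u"
    and cont: "continuous_on (convex hull (u ` {..Suc d})) f" and inj: "inj_on f (convex hull (u ` {..Suc d}))"
    and ij: "i \<le> Suc d" "j \<le> Suc d" "i \<noteq> j"
  shows "simplex_degree f (u \<circ> Transposition.transpose i j) = - simplex_degree f u"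
proof (cases "i = Suc d \<or> j = Suc d")
  case True
  then show ?thesis
    using simplex_degree_swap_base[OF u cont inj, of i] simplex_degree_swap_base[OF u cont inj, of j] ij
    by (metis le_SucE transpose_commute)
next
  case False
  let ?n = "Suc d"
  have perm: "Transposition.transpose k ?n permutes {..?n}" if "k \<le> d" for k
    using that by (intro permutes_swap_id) auto
  have sw: "simplex_degree f (v \<circ> Transposition.transpose k ?n) = - simplex_degree f v
      \<and> simplex_vertices ?n (v \<circ> Transposition.transpose k ?n)
      \<and> (v \<circ> Transposition.transpose k ?n) ` {..?n} = u ` {..?n}"
    if "simplex_vertices ?n v" "v ` {..?n} = u ` {..?n}" "k \<le> d" for v k
  proof (intro conjI)
    show "simplex_degree f (v \<circ> Transposition.transpose k ?n) = - simplex_degree f v"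
      by (rule simplex_degree_swap_base[OF that(1) _ _ that(3)]) (simp_all only: that(2) cont inj)
    show "simplex_vertices ?n (v \<circ> Transposition.transpose k ?n)"
      by (rule simplex_vertices_permute[OF perm[OF that(3)] that(1)])
    show "(v \<circ> Transposition.transpose k ?n) ` {..?n} = u ` {..?n}"
      by (simp only: image_comp[symmetric] permutes_image[OF perm[OF that(3)]] that(2))
  qed
  have "i \<le> d" "j \<le> d" using False ij by auto
  have "u \<circ> Transposition.transpose i j =
        ((u \<circ> Transposition.transpose i ?n) \<circ> Transposition.transpose j ?n) \<circ> Transposition.transpose i ?n"
    using False ij by (auto simp: fun_eq_iff Transposition.transpose_def)
  then show ?thesis
    using sw[OF u refl \<open>i \<le> d\<close>] sw[of "u \<circ> Transposition.transpose i ?n" j]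
      sw[of "(u \<circ> Transposition.transpose i ?n) \<circ> Transposition.transpose j ?n" i] \<open>i \<le> d\<close> \<open>j \<le> d\<close> by simp
qed

end

subsection \<open>Adjacent simplices and permutations of vertices\<close>

text \<open>The barycenter of the facet opposite \<open>u 0\<close>. The zero weight keeps the sum
  over all vertices, so that perturbations are read in barycentric coordinates of the full
  simplex.\<close>

definition facet_barycenter :: "nat \<Rightarrow> (nat \<Rightarrow> 'a::real_vector) \<Rightarrow> 'a" where
  "facet_barycenter d u = (\<Sum>i\<le>Suc d. (if i = 0 then 0 else 1 / (real d + 1)) *\<^sub>R u i)"

lemma facet_barycenter_comb:
  "facet_barycenter d u + s *\<^sub>R comb (edges d u) d x =
    (\<Sum>i\<le>Suc d. ((if i = 0 then 0 else 1 / (real d + 1)) + s * balance d x i) *\<^sub>R u i)"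
  unfolding facet_barycenter_def comb_edges scaleR_sum_right
  by (simp only: scaleR_add_left scaleR_scaleR sum.distrib)

lemma sum_facet_coordinates:
  "(\<Sum>i\<le>Suc d. (if i = 0 then 0 else 1 / (real d + 1)) + s * balance d x i) = 1"
proof -
  have "(\<Sum>i\<le>Suc d. (if i = 0 then 0 else 1 / (real d + 1))) = 1"
    by (subst sum.atMost_Suc_shift) simp
  then show ?thesis
    by (simp only: sum.distrib sum_balance flip: sum_distrib_left)
qed

text \<open>Coordinate 0 vanishes on the facet and must not decrease, hence
  \<open>0 \<le> x 0\<close>. The others start at \<open>1 / (d + 1)\<close> and drop by at most
  \<open>2 (d + 1)\<close> times the factor. The bound 2 leaves room for a centre plus a unit
  vector, each bounded by 1.\<close>

lemma facet_barycenter_comb_in_hull: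
  assumes "\<And>i. i \<le> d \<Longrightarrow> \<bar>x i\<bar> \<le> 2" "0 \<le> x 0"
  shows "facet_barycenter d u + (1 / (2 * (real d + 2)\<^sup>2)) *\<^sub>R comb (edges d u) d x
      \<in> convex hull (u ` {..Suc d})"
  unfolding facet_barycenter_comb
proof (rule convex_hull_image_memI[OF _ _ sum_facet_coordinates])
  fix i assume "i \<in> {..Suc d}"
  let ?s = "1 / (2 * (real d + 2)\<^sup>2)"
  show "0 \<le> (if i = 0 then 0 else 1 / (real d + 1)) + ?s * balance d x i"
  proof (cases "i = 0")
    case False
    have "- balance d x i \<le> (real d + 1) * 2"
      using abs_balance_le[of d x 2 i] assms(1) by (simp add: abs_le_iff)
    then have "?s * (- balance d x i) \<le> ?s * ((real d + 1) * 2)"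
      by (intro mult_left_mono) auto
    also have "1 / (2 * (e + 1)\<^sup>2) * (e * 2) \<le> 1 / e" if "e > 0" for e :: real
    proof -
      have "e * 2 * e \<le> 1 * (2 * (e + 1)\<^sup>2)"
        using that by (simp add: power2_eq_square algebra_simps)
      moreover have "0 < 2 * (e + 1)\<^sup>2"
        using that by simp
      ultimately have "e * 2 * e / (2 * (e + 1)\<^sup>2) \<le> 1"
        by (simp only: pos_divide_le_eq)
      then show ?thesis
        using that by (simp add: pos_le_divide_eq)
    qed
    from this[of "real d + 1"] have "?s * ((real d + 1) * 2) \<le> 1 / (real d + 1)"
      by (simp add: add.assoc)
    finally show ?thesis using False by simp
  qed (use assms(2) in \<open>simp add: balance_def\<close>)
qed auto

lemma comb_head: "comb b d x = x 0 *\<^sub>R b 0 + comb b d (x(0 := 0))"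
proof -
  have "comb b d y = y 0 *\<^sub>R b 0 + (\<Sum>i\<in>{..d} - {0}. y i *\<^sub>R b i)" for y
    unfolding comb_def by (subst sum.remove[of _ 0]) auto
  from this[of x] this[of "x(0 := 0)"] show ?thesis by simp
qed

lemma convex_hull_image_coordinates:
  assumes "simplex_vertices n u" "I \<subseteq> {..n}" "z \<in> convex hull (u ` I)"
  obtains c where "\<And>i. i \<notin> I \<Longrightarrow> c i = 0" "(\<Sum>i\<le>n. c i) = 1" "z = (\<Sum>i\<le>n. c i *\<^sub>R u i)"
proof -
  have I: "finite I" "inj_on u I"
    using assms(2) finite_subset inj_on_subset[OF simplex_vertices_inj_on[OF assms(1)]] by auto
  obtain w where w: "sum w (u ` I) = 1" "(\<Sum>x\<in>u ` I. w x *\<^sub>R x) = z"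
    using assms(3) I(1) by (auto simp: convex_hull_finite)
  define c where "c = (\<lambda>i. if i \<in> I then w (u i) else 0)"
  have "sum w (u ` I) = (\<Sum>i\<in>I. c i)" "(\<Sum>x\<in>u ` I. w x *\<^sub>R x) = (\<Sum>i\<in>I. c i *\<^sub>R u i)"
    using I(2) by (simp_all add: sum.reindex c_def)
  moreover have "(\<Sum>i\<in>I. c i) = (\<Sum>i\<le>n. c i)" "(\<Sum>i\<in>I. c i *\<^sub>R u i) = (\<Sum>i\<le>n. c i *\<^sub>R u i)"
    by (rule sum.mono_neutral_left, simp, simp add: assms(2), simp add: c_def)+
  ultimately show ?thesis
    using w that[of c] by (auto simp: c_def)
qed

lemma simplex_vertices_coordinates_eq:
  assumes "simplex_vertices n u" "sum c {..n} = sum e {..n}" "(\<Sum>i\<le>n. c i *\<^sub>R u i) = (\<Sum>i\<le>n. e i *\<^sub>R u i)" "i \<le> n"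
  shows "c i = e i"
proof -
  have "(\<Sum>i\<le>n. c i - e i) = 0" "(\<Sum>i\<le>n. (c i - e i) *\<^sub>R u i) = 0"
    using assms(2,3) by (simp_all add: sum_subtractf scaleR_diff_left)
  then have "\<forall>i\<le>n. c i - e i = 0"
    using assms(1) unfolding simplex_vertices_def by blast
  then show ?thesis using assms(4) by simp
qed

context orthonormal_frame
begin

text \<open>The piecewise linear map \<open>\<Phi>\<close> sends the half spaces \<open>x 0 \<ge> 0\<close> and \<open>x 0 \<le> 0\<close> to the two
  simplices. The local degree of \<open>f \<circ> \<Phi>\<close> does not change when the centre moves across the
  common facet, but \<open>\<Phi>\<close> reverses the zeroth edge on the second half space.\<close>

lemma simplex_degree_adjacent:
  fixes f :: "'a::euclidean_space \<Rightarrow> 'b" and u :: "nat \<Rightarrow> 'a" and b :: 'a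
  defines "v \<equiv> u(0 := b)"
  assumes u: "simplex_vertices (Suc d) u" and v: "simplex_vertices (Suc d) v"
    and cont: "continuous_on (convex hull (u ` {..Suc d}) \<union> convex hull (v ` {..Suc d})) f"
    and inj: "inj_on f (convex hull (u ` {..Suc d}) \<union> convex hull (v ` {..Suc d}))"
    and meet: "convex hull (u ` {..Suc d}) \<inter> convex hull (v ` {..Suc d}) \<subseteq> convex hull (u ` {1..Suc d})"
  shows "simplex_degree f v = - simplex_degree f u"
proof -
  let ?S = "unit_sphere d"
  define s where "s = 1 / (2 * (real d + 2)\<^sup>2)"
  have s: "s > 0" by (simp add: s_def)
  define q where "q = facet_barycenter d u"
  have qv: "facet_barycenter d v = q"
    unfolding q_def facet_barycenter_def by (intro sum.cong) (auto simp: v_def)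
  define M where "M = convex hull (u ` {..Suc d})"
  define N where "N = convex hull (v ` {..Suc d})"
  \<comment> \<open>The two \<open>max\<close> terms merge both halves into one formula, continuous
    by construction; at most one of them is nonzero at any \<open>x\<close>.\<close>
  define \<Phi> where "\<Phi> = (\<lambda>x. q + s *\<^sub>R (max (x 0) 0 *\<^sub>R (u 0 - u (Suc d)) + max (- x 0) 0 *\<^sub>R (b - u (Suc d))
      + comb (edges d u) d (x(0 := 0))))"
  have \<Phi>_pos: "\<Phi> x = q + s *\<^sub>R comb (edges d u) d x" if "0 \<le> x 0" for x
    using that comb_head[of "edges d u" d x] by (simp add: \<Phi>_def edges_def max_def)
  have tail: "comb (edges d u) d (x(0 := 0)) = comb (edges d v) d (x(0 := 0))" for x
    by (rule comb_cong) (simp add: v_def edges_def)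
  have \<Phi>_neg: "\<Phi> x = q + s *\<^sub>R comb (edges d v) d (x(0 := - x 0))" if "x 0 \<le> 0" for x
    using that comb_head[of "edges d v" d "x(0 := - x 0)"] tail[of x]
        by (simp add: \<Phi>_def edges_def v_def max_def)
  define box where "box = {x::nat \<Rightarrow> real. \<forall>i\<le>d. \<bar>x i\<bar> \<le> 2}"
  have pos_M: "\<Phi> x \<in> M" if "x \<in> box" "0 \<le> x 0" for x
    unfolding \<Phi>_pos[of x, OF that(2)] M_def q_def s_def
    by (rule facet_barycenter_comb_in_hull) (use that in \<open>auto simp: box_def\<close>)
  have neg_N: "\<Phi> x \<in> N" if "x \<in> box" "x 0 \<le> 0" for x
    unfolding \<Phi>_neg[of x, OF that(2)] N_def qv[symmetric] s_def
    by (rule facet_barycenter_comb_in_hull) (use that in \<open>auto simp: box_def\<close>)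
  have box_MN: "\<Phi> x \<in> M \<union> N" if "x \<in> box" for x
    using pos_M[OF that] neg_N[OF that] by fastforce
  \<comment> \<open>The halves can meet only in the common facet. There coordinate 0 with respect to
    \<open>u\<close> vanishes, whereas at \<open>\<Phi> x\<close> it equals
    \<open>s * x 0 > 0\<close>.\<close>
  have opposite: "\<Phi> x \<noteq> \<Phi> y" if "x \<in> box" "y \<in> box" "0 < x 0" "y 0 < 0" for x y
  proof
    assume "\<Phi> x = \<Phi> y"
    then have "\<Phi> x \<in> convex hull (u ` {1..Suc d})"
      using pos_M[OF that(1)] neg_N[OF that(2)] that meet by (auto simp: M_def N_def)
    then obtain e where e: "\<And>i. i \<notin> {1..Suc d} \<Longrightarrow> e i = 0" "(\<Sum>i\<le>Suc d. e i) = 1" "\<Phi> x = (\<Sum>i\<le>Suc d. e i *\<^sub>R u i)"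
      using convex_hull_image_coordinates[OF u, of "{1..Suc d}" "\<Phi> x"] by auto
    let ?c = "\<lambda>i. (if i = 0 then 0 else 1 / (real d + 1)) + s * balance d x i"
    have "\<Phi> x = (\<Sum>i\<le>Suc d. ?c i *\<^sub>R u i)"
      using \<Phi>_pos[of x] that(3) facet_barycenter_comb[of d u s x] by (simp add: q_def)
    then have "?c 0 = e 0"
      using simplex_vertices_coordinates_eq[OF u, of ?c e 0] e sum_facet_coordinates[of d s x] by simp
    then show False using e(1)[of 0] that(3) s by (simp add: balance_def)
  qed
  have inj_\<Phi>: "\<forall>i\<le>d. x i = y i" if "\<Phi> x = \<Phi> y" "x \<in> box" "y \<in> box" for x y
  proof -
    have same: "\<forall>i\<le>d. x i = y i"
      if "simplex_vertices (Suc d) w" "comb (edges d w) d x = comb (edges d w) d y" for w :: "nat \<Rightarrow> 'a" and x y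
    proof -
      have "comb (edges d w) d (\<lambda>i. x i - y i) = 0"
        using that(2) by (simp add: comb_def scaleR_diff_left sum_subtractf)
      then show ?thesis using comb_edges_eq_0D[OF that(1)] by fastforce
    qed
    consider "0 \<le> x 0" "0 \<le> y 0" | "x 0 \<le> 0" "y 0 \<le> 0" | "0 < x 0" "y 0 < 0" | "x 0 < 0" "0 < y 0"
      by linarith
    then show ?thesis
    proof cases
      case 1
      then show ?thesis using that(1) s by (intro same[OF u]) (simp add: \<Phi>_pos)
    next
      case 2
      then have "comb (edges d v) d (x(0 := - x 0)) = comb (edges d v) d (y(0 := - y 0))"
        using that(1) s by (simp add: \<Phi>_neg)
      then have *: "\<forall>i\<le>d. (x(0 := - x 0)) i = (y(0 := - y 0)) i"
        by (rule same[OF v])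
      show ?thesis
      proof (intro allI impI)
        fix i assume "i \<le> d"
        with * show "x i = y i" by (cases "i = 0") force+
      qed
    qed (use opposite[of x y] opposite[of y x] that in auto)
  qed
  \<comment> \<open>The centre moves from \<open>x 0 = 1\<close> to \<open>x 0 = -1\<close> and
    passes the barycenter of the facet at \<open>t = 1/2\<close>. At both ends the unit sphere about
    it lies in one closed half space, so a single affine piece of \<Phi> is involved.\<close>
  define e where "e = (\<lambda>t (i::nat). if i = 0 then 1 - 2 * t else (0::real))"
  have e_box: "e t \<in> box" "(\<lambda>i. e t i + x i) \<in> box" if "0 \<le> t" "t \<le> 1" "x \<in> ?S" for t x
  proof -
    have 1: "\<bar>e t i\<bar> \<le> 1" for i using that by (auto simp: e_def)
    show "e t \<in> box" unfolding box_def using order_trans[OF 1] by simp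
    have "\<bar>e t i + x i\<bar> \<le> 2" for i
      using 1[of i] unit_sphere_abs_le[OF that(3), of i] by linarith
    then show "(\<lambda>i. e t i + x i) \<in> box" unfolding box_def by simp
  qed
  have cont_\<Phi>: "continuous_on X (\<lambda>z. \<Phi> (h z))" if "continuous_on X h" for X :: "(real \<times> (nat \<Rightarrow> real)) set" and h
  proof -
    have h0: "continuous_on X (\<lambda>z. h z i)" for i
      by (rule continuous_on_product_then_coordinatewise[OF that])
    have h: "continuous_on X (\<lambda>z. (h z)(0 := 0))"
    proof (rule continuous_on_coordinatewise_then_product)
      show "continuous_on X (\<lambda>z. ((h z)(0 := 0)) i)" for i
        by (cases "i = 0") (auto intro: h0)
    qed
    show ?thesis
      unfolding \<Phi>_def
      by (intro continuous_on_add continuous_on_const continuous_on_scaleR continuous_on_max continuous_on_minus h0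
          continuous_on_comb h)
  qed
  have ce: "continuous_on X (\<lambda>z. e (fst z))" for X :: "(real \<times> (nat \<Rightarrow> real)) set"
  proof (rule continuous_on_coordinatewise_then_product)
    show "continuous_on X (\<lambda>z. e (fst z) i)" for i
      unfolding e_def by (cases "i = 0") (auto intro!: continuous_intros)
  qed
  have cex: "continuous_on X (\<lambda>z i. e (fst z) i + snd z i)" for X :: "(real \<times> (nat \<Rightarrow> real)) set"
    by (intro continuous_on_coordinatewise_then_product continuous_on_add
        continuous_on_product_then_coordinatewise[OF ce]
        continuous_on_product_then_coordinatewise[OF continuous_on_snd[OF continuous_on_id]])
  let ?H = "\<lambda>t x. f (\<Phi> (\<lambda>i. e t i + x i)) - f (\<Phi> (e t))"
  have "sphere_degree \<beta> d (?H 0) = sphere_degree \<beta> d (?H 1)"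
  proof (rule sphere_degree_homotopy)
    have "continuous_on ({0..1} \<times> ?S) (\<lambda>z. f (\<Phi> (\<lambda>i. e (fst z) i + snd z i)))"
      by (rule continuous_on_compose2[OF cont cont_\<Phi>[OF cex]])
        (use box_MN[OF e_box(2)] in \<open>force simp: M_def N_def\<close>)
    moreover have "continuous_on ({0..1} \<times> ?S) (\<lambda>z. f (\<Phi> (e (fst z))))"
      by (rule continuous_on_compose2[OF cont cont_\<Phi>[OF ce]])
        (use box_MN[OF e_box(1)] in \<open>force simp: M_def N_def\<close>)
    ultimately have "continuous_on ({0..1} \<times> ?S)
        (\<lambda>z. f (\<Phi> (\<lambda>i. e (fst z) i + snd z i)) - f (\<Phi> (e (fst z))))"
      by (rule continuous_on_diff)
    then show "continuous_on ({0..1} \<times> ?S) (\<lambda>(t, x). ?H t x)"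
      by (simp add: case_prod_unfold)
    show "?H t x \<noteq> 0" if "0 \<le> t" "t \<le> 1" "x \<in> ?S" for t x
    proof
      assume "?H t x = 0"
      then have "\<Phi> (\<lambda>i. e t i + x i) = \<Phi> (e t)"
        using box_MN[OF e_box(1)[OF that]] box_MN[OF e_box(2)[OF that]]
        by (intro inj_onD[OF inj]) (auto simp: M_def N_def)
      then have "\<forall>i\<le>d. x i = 0"
        using inj_\<Phi>[OF _ e_box(2)[OF that] e_box(1)[OF that]] by fastforce
      then show False using unit_sphere_eq_0D[OF that(3)] by blast
    qed
  qed
  \<comment> \<open>Each end position is carried to the barycenter of its own simplex. Both frames
    are positive multiples of the edges, hence so is every frame in between.\<close>
  moreover have to_center: "local_degree f (q + s *\<^sub>R comb (edges d w) d (e 0)) (\<lambda>i. s *\<^sub>R edges d w i)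
      = simplex_degree f w"
    if w: "simplex_vertices (Suc d) w" "facet_barycenter d w = q"
      "continuous_on (convex hull (w ` {..Suc d})) f" "inj_on f (convex hull (w ` {..Suc d}))" for w
    unfolding simplex_degree_def
  proof (rule local_degree_homotopy[OF convex_convex_hull w(3,4) _ _ barycenter_in_hull])
    show "q + s *\<^sub>R comb (edges d w) d (e 0) \<in> convex hull (w ` {..Suc d})"
      unfolding w(2)[symmetric] s_def
      by (rule facet_barycenter_comb_in_hull) (auto simp: e_def)
    fix x assume x: "x \<in> ?S"
    have "q + s *\<^sub>R comb (edges d w) d (e 0) + comb (\<lambda>i. s *\<^sub>R edges d w i) d x =
        q + s *\<^sub>R comb (edges d w) d (\<lambda>i. e 0 i + x i)"
      by (simp add: comb_add comb_scaleR scaleR_add_right)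
    also have "\<dots> \<in> convex hull (w ` {..Suc d})"
      unfolding w(2)[symmetric] s_def
    proof (rule facet_barycenter_comb_in_hull)
      show "\<bar>e 0 i + x i\<bar> \<le> 2" for i
        using unit_sphere_abs_le[OF x, of i] by (auto simp: e_def)
      show "0 \<le> e 0 0 + x 0"
        using unit_sphere_abs_le[OF x, of 0] by (simp add: e_def)
    qed
    finally show "q + s *\<^sub>R comb (edges d w) d (e 0) + comb (\<lambda>i. s *\<^sub>R edges d w i) d x
        \<in> convex hull (w ` {..Suc d})" .
    show "barycenter d w + comb (simplex_frame d w) d x \<in> convex hull (w ` {..Suc d})"
      by (rule barycenter_comb_in_hull) (rule unit_sphere_abs_le[OF x])
    fix t :: real assume t: "0 \<le> t" "t \<le> 1"
    define r where "r = (1 - t) * s + t * (1 / (real d + 2)\<^sup>2)"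
    have "r > 0"
      unfolding r_def using t s by (cases "t = 0") (auto intro: add_nonneg_pos)
    have "comb (\<lambda>i. (1 - t) *\<^sub>R s *\<^sub>R edges d w i + t *\<^sub>R simplex_frame d w i) d x = r *\<^sub>R comb (edges d w) d x"
      unfolding comb_scaleR[symmetric] by (simp add: simplex_frame_def r_def scaleR_add_left)
    then show "comb (\<lambda>i. (1 - t) *\<^sub>R s *\<^sub>R edges d w i + t *\<^sub>R simplex_frame d w i) d x \<noteq> 0"
      using \<open>r > 0\<close> comb_edges_eq_0D[OF w(1), of x] unit_sphere_eq_0D[OF x] by auto
  qed
  moreover have "sphere_degree \<beta> d (?H 0)
      = local_degree f (q + s *\<^sub>R comb (edges d u) d (e 0)) (\<lambda>i. s *\<^sub>R edges d u i)"
    unfolding local_degree_def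
  proof (rule sphere_degree_cong)
    fix x assume "x \<in> ?S"
    then have "0 \<le> e 0 0 + x 0" using unit_sphere_abs_le[of x d 0] by (simp add: e_def)
    then show "?H 0 x = f (q + s *\<^sub>R comb (edges d u) d (e 0) + comb (\<lambda>i. s *\<^sub>R edges d u i) d x)
        - f (q + s *\<^sub>R comb (edges d u) d (e 0))"
      by (simp add: \<Phi>_pos comb_add comb_scaleR scaleR_add_right add.assoc e_def)
  qed
  \<comment> \<open>At the far end \<Phi> negates coordinate 0 before applying the edges of
    \<open>v\<close>. For the centre this turns \<open>e 1\<close> into \<open>e 0\<close>; for the
    sphere variable it amounts to a reflected edge 0, the source of the minus sign.\<close>
  moreover have "sphere_degree \<beta> d (?H 1) =
      local_degree f (q + s *\<^sub>R comb (edges d v) d (e 0)) ((\<lambda>i. s *\<^sub>R edges d v i)(0 := - (s *\<^sub>R edges d v 0)))"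
    unfolding local_degree_def
  proof (rule sphere_degree_cong)
    fix x assume "x \<in> ?S"
    then have le: "e 1 0 + x 0 \<le> 0" using unit_sphere_abs_le[of x d 0] by (simp add: e_def)
    have 1: "(\<lambda>i. e 1 i + x i)(0 := - (e 1 0 + x 0))
        = (\<lambda>i. e 0 i + (x(0 := - x 0)) i)" "(e 1)(0 := - e 1 0) = e 0"
      by (auto simp: e_def fun_eq_iff)
    have 2: "\<Phi> (\<lambda>i. e 1 i + x i) = q + s *\<^sub>R comb (edges d v) d (\<lambda>i. e 0 i + (x(0 := - x 0)) i)"
      unfolding 1(1)[symmetric] by (rule \<Phi>_neg) (rule le)
    have 3: "\<Phi> (e 1) = q + s *\<^sub>R comb (edges d v) d (e 0)"
      unfolding 1(2)[symmetric] by (rule \<Phi>_neg) (simp add: e_def)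
    have 4: "comb ((\<lambda>i. s *\<^sub>R edges d v i)(0 := - (s *\<^sub>R edges d v 0))) d x
        = s *\<^sub>R comb (edges d v) d (x(0 := - x 0))"
      using comb_scaleR[of s "edges d v" d "x(0 := - x 0)"] comb_reflect[of "\<lambda>i. s *\<^sub>R edges d v i" d x 0]
      by simp
    show "?H 1 x = f (q + s *\<^sub>R comb (edges d v) d (e 0) + comb ((\<lambda>i. s *\<^sub>R edges d v i)(0 := - (s *\<^sub>R edges d v 0))) d x)
        - f (q + s *\<^sub>R comb (edges d v) d (e 0))"
      unfolding 2 3 4 comb_add by (simp only: scaleR_add_right add.assoc)
  qed
  moreover have "local_degree f (q + s *\<^sub>R comb (edges d v) d (e 0)) ((\<lambda>i. s *\<^sub>R edges d v i)(0 := - (s *\<^sub>R edges d v 0)))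
      = - local_degree f (q + s *\<^sub>R comb (edges d v) d (e 0)) (\<lambda>i. s *\<^sub>R edges d v i)"
  proof (rule local_degree_reflect[where M = N])
    show "continuous_on N f" "inj_on f N"
      using continuous_on_subset[OF cont] inj_on_subset[OF inj] by (auto simp: N_def)
    show "q + s *\<^sub>R comb (edges d v) d (e 0) \<in> N"
      unfolding qv[symmetric] s_def N_def
      by (rule facet_barycenter_comb_in_hull) (auto simp: e_def)
    fix x assume x: "x \<in> ?S"
    have "q + s *\<^sub>R comb (edges d v) d (e 0) + comb (\<lambda>i. s *\<^sub>R edges d v i) d x =
        q + s *\<^sub>R comb (edges d v) d (\<lambda>i. e 0 i + x i)"
      by (simp add: comb_add comb_scaleR scaleR_add_right)
    also have "\<dots> \<in> N"
      unfolding qv[symmetric] s_def N_def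
    proof (rule facet_barycenter_comb_in_hull)
      show "\<bar>e 0 i + x i\<bar> \<le> 2" for i
        using unit_sphere_abs_le[OF x, of i] by (auto simp: e_def)
      show "0 \<le> e 0 0 + x 0"
        using unit_sphere_abs_le[OF x, of 0] by (simp add: e_def)
    qed
    finally show "q + s *\<^sub>R comb (edges d v) d (e 0) + comb (\<lambda>i. s *\<^sub>R edges d v i) d x \<in> N" .
    show "comb (\<lambda>i. s *\<^sub>R edges d v i) d x \<noteq> 0"
      using s comb_edges_eq_0D[OF v, of x] unit_sphere_eq_0D[OF x] by (auto simp: comb_scaleR)
  qed simp
  moreover have "continuous_on M f" "inj_on f M" "continuous_on N f" "inj_on f N"
    using continuous_on_subset[OF cont] inj_on_subset[OF inj] by (auto simp: M_def N_def)
  ultimately show ?thesis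
    using to_center[OF u q_def[symmetric]] to_center[OF v qv] by (simp add: M_def N_def)
qed

text \<open>Bundled because these conditions survive transpositions of the vertices and have to be
  carried through inductions over them.\<close>

definition embedded_simplex :: "('a::euclidean_space \<Rightarrow> 'b) \<Rightarrow> (nat \<Rightarrow> 'a) \<Rightarrow> bool" where
  "embedded_simplex f u \<longleftrightarrow> simplex_vertices (Suc d) u \<and>
     continuous_on (convex hull (u ` {..Suc d})) f \<and> inj_on f (convex hull (u ` {..Suc d}))"

lemma embedded_simplex_transpose:
  assumes "embedded_simplex f u" "i \<le> Suc d" "j \<le> Suc d"
  shows "embedded_simplex f (u \<circ> Transposition.transpose i j)"
proof -
  have perm: "Transposition.transpose i j permutes {..Suc d}"
    using assms by (intro permutes_swap_id) auto
  then have "(u \<circ> Transposition.transpose i j) ` {..Suc d} = u ` {..Suc d}"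
    by (simp only: image_comp[symmetric] permutes_image)
  moreover have "simplex_vertices (Suc d) (u \<circ> Transposition.transpose i j)"
    using assms(1) by (intro simplex_vertices_permute[OF perm]) (simp add: embedded_simplex_def)
  ultimately show ?thesis
    using assms(1) by (simp only: embedded_simplex_def simp_thms)
qed

text \<open>Vertex 0 stands for the vertex off the facet, and \<open>p\<close> reorders the facet.
  The induction absorbs the outer transposition into \<open>u\<close>, which is why \<open>u\<close>
  has to vary.\<close>

lemma simplex_degree_permute_tail:
  assumes "p permutes {..d}" "embedded_simplex f u"
  shows "simplex_degree f (\<lambda>j. case j of 0 \<Rightarrow> u 0 | Suc j \<Rightarrow> u (Suc (p j))) = sign p * simplex_degree f u"
  using assms(1) finite_atMost[of d] assms(2)
proof (induction arbitrary: u rule: permutes_induct)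
  case id
  have "(\<lambda>j. case j of 0 \<Rightarrow> u 0 | Suc j \<Rightarrow> u (Suc (id j))) = u"
    by (auto simp: fun_eq_iff split: nat.split)
  then show ?case by simp
next
  case (swap a b p)
  show ?case
  proof (cases "a = b")
    case False
    let ?u = "u \<circ> Transposition.transpose (Suc a) (Suc b)"
    have ab: "Suc a \<le> Suc d" "Suc b \<le> Suc d" "Suc a \<noteq> Suc b"
      using swap False by auto
    have u: "simplex_vertices (Suc d) u" "continuous_on (convex hull (u ` {..Suc d})) f"
        "inj_on f (convex hull (u ` {..Suc d}))"
      using swap.prems by (simp_all add: embedded_simplex_def)
    have "(\<lambda>j. case j of 0 \<Rightarrow> u 0 | Suc j \<Rightarrow> u (Suc ((Transposition.transpose a b \<circ> p) j))) =
        (\<lambda>j. case j of 0 \<Rightarrow> ?u 0 | Suc j \<Rightarrow> ?u (Suc (p j)))"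
      by (auto simp: fun_eq_iff Transposition.transpose_def split: nat.split)
    then have "simplex_degree f (\<lambda>j. case j of 0 \<Rightarrow> u 0 | Suc j \<Rightarrow> u (Suc ((Transposition.transpose a b \<circ> p) j))) =
        sign p * simplex_degree f ?u"
      by (simp only: swap.IH[OF embedded_simplex_transpose[OF swap.prems ab(1,2)]])
    also have "simplex_degree f ?u = - simplex_degree f u"
      by (rule simplex_degree_transpose[OF u ab])
    finally have "simplex_degree f (\<lambda>j. case j of 0 \<Rightarrow> u 0 | Suc j \<Rightarrow> u (Suc ((Transposition.transpose a b \<circ> p) j))) =
        - sign p * simplex_degree f u"
      by (simp only: mult_minus_right mult_minus_left)
    moreover have "permutation p"
      using \<open>p permutes {..d}\<close> by (metis finite_atMost permutation_permutes)
    then have "sign (Transposition.transpose a b \<circ> p) = - sign p"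
      using False by (simp only: sign_compose[OF permutation_swap_id] sign_swap_id if_False mult_minus_left mult_1)
    ultimately show ?thesis by (simp only:)
  qed (use swap in simp)
qed

text \<open>Vertex 0 reaches position \<open>i\<close> through \<open>i\<close> adjacent
  transpositions. This accounts for the sign in the boundary formula.\<close>

lemma simplex_degree_insert:
  assumes "i \<le> Suc d" "embedded_simplex f u"
  shows "simplex_degree f (\<lambda>j. if j < i then u (Suc j) else if j
      = i then u 0 else u j) = (- 1) ^ i * simplex_degree f u"
proof -
  let ?v = "\<lambda>i j. if j < i then u (Suc j) else if j = i then u 0 else u j"
  have "embedded_simplex f (?v i) \<and> simplex_degree f (?v i) = (- 1) ^ i * simplex_degree f u"
    using assms(1)
  proof (induction i)
    case 0
    have "?v 0 = u" by auto
    then show ?case using assms(2) by simp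
  next
    case (Suc i)
    have eq: "?v (Suc i) = ?v i \<circ> Transposition.transpose i (Suc i)"
      by (auto simp: fun_eq_iff Transposition.transpose_def)
    have IH: "embedded_simplex f (?v i)" "simplex_degree f (?v i) = (- 1) ^ i * simplex_degree f u"
      using Suc by auto
    have "embedded_simplex f (?v (Suc i))"
      unfolding eq by (rule embedded_simplex_transpose[OF IH(1)]) (use Suc.prems in auto)
    moreover have "simplex_degree f (?v (Suc i)) = - simplex_degree f (?v i)"
      unfolding eq using IH(1) Suc.prems
      by (intro simplex_degree_transpose) (auto simp: embedded_simplex_def)
    ultimately show ?case using IH(2) by simp
  qed
  then show ?thesis by blast
qed

end

subsection \<open>The boundary matrix\<close>

text \<open>The generators are recovered as the extreme points of the hull.\<close>

lemma convex_hull_affine_independent_inject: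
  fixes A B :: "'a::euclidean_space set"
  assumes "\<not> affine_dependent A" "\<not> affine_dependent B" "convex hull A = convex hull B"
  shows "A = B"
  using extreme_point_of_convex_hull_affine_independent[OF assms(1)]
    extreme_point_of_convex_hull_affine_independent[OF assms(2)] assms(3)
  by auto

lemma orientation_simplex:
  assumes "orientation K ori" "S \<in> simplices K k"
  shows "distinct (ori S)" "length (ori S) = Suc k" "\<not> affine_dependent (set (ori S))"
    "S = convex hull (set (ori S))"
proof -
  obtain C where C: "\<not> affine_dependent C" "int (card C) = int k + 1" "S = convex hull C"
    using assms(2) by (auto simp: simplices_def simplex_def)
  have ori: "distinct (ori S)" "set (ori S) = {v. v extreme_point_of S}"
    using assms by (auto simp: orientation_def simplices_def)
  have "set (ori S) = C"
    using ori(2) extreme_point_of_convex_hull_affine_independent[OF C(1)] C(3) by auto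
  then show "distinct (ori S)" "length (ori S) = Suc k" "\<not> affine_dependent (set (ori S))"
    "S = convex hull (set (ori S))"
    using ori(1) C distinct_card[OF ori(1)] by auto
qed

lemma boundary_matrix_eq:
  assumes "finite K" "S \<in> simplices K k"
  shows "boundary_matrix K ori k F S =
    (\<Sum>i<length (ori S). (- 1) ^ i * Defs.oriented_simplex ori (take i (ori S) @ drop (Suc i) (ori S)) F)"
proof -
  have "finite (simplices K k)"
    using assms(1) by (simp add: simplices_def)
  then show ?thesis
    using assms(2) unfolding boundary_matrix_def boundary_def
    by (simp add: sum.delta' if_distrib[of "\<lambda>z. z * _"] of_bool_def cong: if_cong)
qed

text \<open>Distinctness determines \<open>p\<close> on the indices, and \<open>permutes\<close>
  fixes it elsewhere; so the \<open>THE\<close> in \<open>reordering_sign\<close> picks a unique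
  permutation.\<close>

lemma reordering_sign_eq:
  assumes "distinct xs" "distinct ys" "set xs = set ys"
  obtains p where "p permutes {..<length xs}" "permute_list p xs = ys" "reordering_sign xs ys = sign p"
proof -
  have "mset ys = mset xs"
    using assms set_eq_iff_mset_eq_distinct by metis
  then obtain p where p: "p permutes {..<length xs}" "permute_list p xs = ys"
    by (rule mset_eq_permutation)
  have "q = p" if q: "q permutes {..<length xs}" "permute_list q xs = ys" for q
  proof
    fix i
    show "q i = p i"
    proof (cases "i < length xs")
      case True
      then have "xs ! q i = xs ! p i"
        using permute_list_nth[OF p(1) True] permute_list_nth[OF q(1) True] p(2) q(2) by simp
      moreover have "q i < length xs" "p i < length xs"
        using True permutes_in_image[OF p(1), of i] permutes_in_image[OF q(1), of i] by auto
      ultimately show ?thesis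
        using nth_eq_iff_index_eq[OF assms(1)] by simp
    qed (simp add: permutes_not_in[OF p(1)] permutes_not_in[OF q(1)])
  qed
  then have "(THE p. p permutes {..<length xs} \<and> permute_list p xs = ys) = p"
    by (intro the_equality conjI p) blast
  then show ?thesis
    by (intro that[OF p]) (simp add: reordering_sign_def)
qed

lemma image_nth_atMost: "length xs = Suc n \<Longrightarrow> (!) xs ` {..n} = set xs"
  by (auto simp: set_conv_nth less_Suc_eq_le)

lemma delete_nth:
  assumes "distinct xs" "i < length xs"
  shows "distinct (take i xs @ drop (Suc i) xs)" "set (take i xs @ drop (Suc i) xs) = set xs - {xs ! i}"
    "length (take i xs @ drop (Suc i) xs) = length xs - 1"
proof -
  have xs: "xs = take i xs @ xs ! i # drop (Suc i) xs"
    using assms(2) by (rule id_take_nth_drop)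
  have "distinct (take i xs @ xs ! i # drop (Suc i) xs)"
    using assms(1) xs by simp
  then show "distinct (take i xs @ drop (Suc i) xs)"
    by simp
  have "set xs = set (take i xs @ xs ! i # drop (Suc i) xs)"
    using xs by simp
  then show "set (take i xs @ drop (Suc i) xs) = set xs - {xs ! i}"
    using \<open>distinct (take i xs @ xs ! i # drop (Suc i) xs)\<close> by auto
  show "length (take i xs @ drop (Suc i) xs) = length xs - 1"
    using assms(2) by simp
qed

context orthonormal_frame
begin

lemma embedded_simplex_nth:
  assumes "distinct xs" "length xs = d + 2" "\<not> affine_dependent (set xs)"
    "continuous_on (convex hull (set xs)) f" "inj_on f (convex hull (set xs))"
  shows "embedded_simplex f ((!) xs)"
  using assms simplex_verticesI[of "(!) xs" "Suc d"] image_nth_atMost[of xs "Suc d"]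
  by (auto simp: embedded_simplex_def inj_on_def nth_eq_iff_index_eq)

text \<open>The entry is the sign of the reordering between \<open>ori S\<close> and
  \<open>a # ori F\<close>, where \<open>a\<close> is the vertex off \<open>F\<close>, and the
  degree of \<open>S\<close> changes by the same sign. The product therefore no longer depends on
  \<open>ori S\<close>, which makes different simplices at \<open>F\<close> comparable.\<close>

lemma boundary_matrix_simplex_degree:
  fixes f :: "'a::euclidean_space \<Rightarrow> 'b"
  assumes K: "finite K" and ori: "orientation K ori"
    and F: "F \<in> simplices K d" and S: "S \<in> simplices K (d + 1)"
    and f: "continuous_on S f" "inj_on f S"
    and nz: "boundary_matrix K ori (d + 1) F S \<noteq> 0"
  obtains a where "a \<notin> set (ori F)" "set (ori S) = insert a (set (ori F))"
    "boundary_matrix K ori (d + 1) F S \<in> {1, -1}"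
    "boundary_matrix K ori (d + 1) F S * simplex_degree f ((!) (ori S)) = simplex_degree f ((!) (a # ori F))"
proof -
  define xs where "xs = ori S"
  define vs where "vs = ori F"
  define del where "del = (\<lambda>i. take i xs @ drop (Suc i) xs)"
  have xs: "distinct xs" "length xs = d + 2" "\<not> affine_dependent (set xs)" "S = convex hull (set xs)"
    using orientation_simplex[OF ori S] by (simp_all add: xs_def)
  have vs: "distinct vs" "length vs = Suc d" "\<not> affine_dependent (set vs)" "F = convex hull (set vs)"
    using orientation_simplex[OF ori F] by (simp_all add: vs_def)
  have del: "distinct (del i)" "set (del i) = set xs - {xs ! i}" "length (del i) = Suc d" if "i < d + 2" for i
    using delete_nth[OF xs(1), of i] that xs(2) by (auto simp: del_def)
  have F_iff: "F = convex hull (set (del i)) \<longleftrightarrow> set vs = set (del i)" if "i < d + 2" for i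
  proof -
    have "\<not> affine_dependent (set (del i))"
      using xs(3) del(2)[OF that] affine_independent_subset[of "set xs" "set (del i)"] by auto
    then have "convex hull (set vs) = convex hull (set (del i)) \<longleftrightarrow> set vs = set (del i)"
      using convex_hull_affine_independent_inject[OF vs(3)] by metis
    then show ?thesis
      by (simp only: vs(4))
  qed
  have entry: "boundary_matrix K ori (d + 1) F S = (\<Sum>i<d + 2. (- 1) ^ i * Defs.oriented_simplex ori (del i) F)"
    using boundary_matrix_eq[OF K S, of ori F] xs(2) by (simp add: del_def xs_def)
  then obtain i where i: "i < d + 2" "Defs.oriented_simplex ori (del i) F \<noteq> 0"
    using nz by (metis (no_types, lifting) lessThan_iff mult_zero_right sum.neutral)
  then have Fi: "F = convex hull (set (del i))" and vs_del: "set vs = set (del i)"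
    using F_iff by (auto simp: Defs.oriented_simplex_def split: if_splits)
  \<comment> \<open>For \<open>j\<close> other than \<open>i\<close>, \<open>del j\<close> omits a
    vertex that belongs to \<open>F\<close>; so only one summand survives.\<close>
  have "Defs.oriented_simplex ori (del j) F = 0" if "j < d + 2" "j \<noteq> i" for j
  proof -
    have "xs ! i \<noteq> xs ! j"
      using xs(1,2) i(1) that by (simp add: nth_eq_iff_index_eq)
    then have "xs ! j \<in> set vs"
      unfolding vs_del del(2)[OF i(1)] using nth_mem[of j xs] that(1) xs(2) by simp
    moreover have "xs ! j \<notin> set (del j)"
      unfolding del(2)[OF that(1)] by simp
    ultimately have "set vs \<noteq> set (del j)"
      by blast
    then show ?thesis
      using F_iff[OF that(1)] by (simp add: Defs.oriented_simplex_def)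
  qed
  then have "(\<Sum>i<d + 2. (- 1) ^ i * Defs.oriented_simplex ori (del i) F) =
      (\<Sum>j\<in>{i}. (- 1) ^ j * Defs.oriented_simplex ori (del j) F)"
    using i(1) by (intro sum.mono_neutral_right) auto
  then have entry: "boundary_matrix K ori (d + 1) F S = (- 1) ^ i * reordering_sign vs (del i)"
    using entry Fi by (simp add: Defs.oriented_simplex_def vs_def)
  obtain p where p: "p permutes {..<length vs}" "permute_list p vs
      = del i" "reordering_sign vs (del i) = sign p"
    using reordering_sign_eq[OF vs(1) del(1)[OF i(1)] vs_del] .
  have p': "p permutes {..d}"
    using p(1) vs(2) by (simp add: lessThan_Suc_atMost)
  define a where "a = xs ! i"
  have a: "a \<notin> set vs" "set xs = insert a (set vs)"
    unfolding vs_del del(2)[OF i(1)] a_def using nth_mem[of i xs] i(1) xs(2) by auto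
  have emb_del: "embedded_simplex f ((!) (a # del i))" and emb_vs: "embedded_simplex f ((!) (a # vs))"
    using a vs_del xs vs(1,2) del(1,3)[OF i(1)] f by (auto intro!: embedded_simplex_nth)
  have "simplex_degree f ((!) xs) = simplex_degree f
      (\<lambda>j. if j < i then (a # del i) ! Suc j else if j = i then (a # del i) ! 0 else (a # del i) ! j)"
    by (rule simplex_degree_cong)
      (use i(1) xs(2) in \<open>auto simp: a_def del_def nth_append nth_Cons' min_def\<close>)
  also have "\<dots> = (- 1) ^ i * simplex_degree f ((!) (a # del i))"
    by (rule simplex_degree_insert) (use i(1) emb_del in auto)
  also have "simplex_degree f ((!) (a # del i)) =
      simplex_degree f (\<lambda>j. case j of 0 \<Rightarrow> (a # vs) ! 0 | Suc j \<Rightarrow> (a # vs) ! Suc (p j))"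
    by (rule simplex_degree_cong)
      (use p(1,2) vs(2) in \<open>auto simp: permute_list_nth simp flip: p(2) split: nat.split\<close>)
  also have "\<dots> = sign p * simplex_degree f ((!) (a # vs))"
    by (rule simplex_degree_permute_tail[OF p' emb_vs])
  finally have deg: "simplex_degree f ((!) xs) = (- 1) ^ i * (sign p * simplex_degree f ((!) (a # vs)))" .
  have sq: "(- 1) ^ i * (- 1) ^ i = (1::int)" "sign p * sign p = 1"
    by (simp_all add: power_mult_distrib[symmetric] sign_idempotent)
  show ?thesis
  proof (rule that)
    show "a \<notin> set (ori F)" "set (ori S) = insert a (set (ori F))"
      using a by (simp_all add: vs_def xs_def)
    show "boundary_matrix K ori (d + 1) F S \<in> {1, -1}"
      unfolding entry p(3) by (cases "even i") (auto simp: sign_def)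
    have "boundary_matrix K ori (d + 1) F S * simplex_degree f ((!) xs) =
        ((- 1) ^ i * (- 1) ^ i) * ((sign p * sign p) * simplex_degree f ((!) (a # vs)))"
      unfolding entry p(3) deg by (simp only: mult_ac)
    then show "boundary_matrix K ori (d + 1) F S * simplex_degree f ((!) (ori S))
        = simplex_degree f ((!) (a # ori F))"
      unfolding sq by (simp add: xs_def vs_def)
  qed
qed

text \<open>By the preceding lemma the two products are the degrees of \<open>a # vs\<close> and
  \<open>b # vs\<close>, which differ in vertex 0 only. They are adjacent in the required sense
  because \<open>S \<inter> T\<close> is a face of both, hence spanned by common vertices, and
  \<open>a \<noteq> b\<close> leaves only vertices of \<open>F\<close>.\<close>

lemma boundary_matrix_opposite:
  fixes f :: "'a::euclidean_space \<Rightarrow> 'b"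
  assumes K: "simplicial_complex K" and ori: "orientation K ori"
    and F: "F \<in> simplices K d" and S: "S \<in> simplices K (d + 1)" and T: "T \<in> simplices K (d + 1)" "S \<noteq> T"
    and f: "continuous_on (\<Union>K) f" "inj_on f (\<Union>K)"
    and nz: "boundary_matrix K ori (d + 1) F S \<noteq> 0" "boundary_matrix K ori (d + 1) F T \<noteq> 0"
  shows "boundary_matrix K ori (d + 1) F T * simplex_degree f ((!) (ori T)) =
    - (boundary_matrix K ori (d + 1) F S * simplex_degree f ((!) (ori S)))"
proof -
  define vs where "vs = ori F"
  have fin: "finite K" using K by (simp add: simplicial_complex_def)
  have ST: "S \<in> K" "T \<in> K" using S T by (auto simp: simplices_def)
  have fS: "continuous_on S f" "inj_on f S" and fT: "continuous_on T f" "inj_on f T"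
    using continuous_on_subset[OF f(1)] inj_on_subset[OF f(2)] ST by (meson Union_upper)+
  have fST: "continuous_on (S \<union> T) f" "inj_on f (S \<union> T)"
    by (rule continuous_on_subset[OF f(1)], use ST in blast, rule inj_on_subset[OF f(2)], use ST in blast)
  obtain a where a: "a \<notin> set vs" "set (ori S) = insert a (set vs)"
    "boundary_matrix K ori (d + 1) F S * simplex_degree f ((!) (ori S)) = simplex_degree f ((!) (a # vs))"
    using boundary_matrix_simplex_degree[OF fin ori F S fS nz(1)] unfolding vs_def by metis
  obtain b where b: "b \<notin> set vs" "set (ori T) = insert b (set vs)"
    "boundary_matrix K ori (d + 1) F T * simplex_degree f ((!) (ori T)) = simplex_degree f ((!) (b # vs))"
    using boundary_matrix_simplex_degree[OF fin ori F T(1) fT nz(2)] unfolding vs_def by metis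
  have vs: "distinct vs" "length vs = Suc d"
    using orientation_simplex[OF ori F] by (simp_all add: vs_def)
  have Sh: "\<not> affine_dependent (insert a (set vs))" "S = convex hull (insert a (set vs))"
    using orientation_simplex[OF ori S] a(2) by simp_all
  have Th: "\<not> affine_dependent (insert b (set vs))" "T = convex hull (insert b (set vs))"
    using orientation_simplex[OF ori T(1)] b(2) by simp_all
  have "a \<noteq> b" using T(2) Sh(2) Th(2) by auto
  let ?u = "(!) (a # vs)"
  have upd: "?u(0 := b) = (!) (b # vs)"
    by (auto simp: fun_eq_iff nth_Cons split: nat.split)
  have imu: "?u ` {..Suc d} = insert a (set vs)" and imv: "(!) (b # vs) ` {..Suc d} = insert b (set vs)"
    using image_nth_atMost[of "a # vs" "Suc d"] image_nth_atMost[of "b # vs" "Suc d"] vs(2) by auto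
  have face: "S \<inter> T face_of S" "S \<inter> T face_of T"
    using K ST unfolding simplicial_complex_def by (blast, metis inf_commute)
  obtain A where A: "A \<subseteq> insert a (set vs)" "S \<inter> T = convex hull A"
    using face_of_convex_hull_affine_independent[OF Sh(1), THEN iffD1, OF face(1)[unfolded Sh(2)]]
    unfolding Sh(2)[symmetric] by (elim exE conjE)
  obtain B where B: "B \<subseteq> insert b (set vs)" "S \<inter> T = convex hull B"
    using face_of_convex_hull_affine_independent[OF Th(1), THEN iffD1, OF face(2)[unfolded Th(2)]]
    unfolding Th(2)[symmetric] by (elim exE conjE)
  have "\<not> affine_dependent A" "\<not> affine_dependent B"
    using affine_independent_subset[OF Sh(1) A(1)] affine_independent_subset[OF Th(1) B(1)] by auto
  then have "A = B"
    by (rule convex_hull_affine_independent_inject) (simp only: flip: A(2) B(2))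
  then have "A \<subseteq> set vs"
    using A(1) B(1) \<open>a \<noteq> b\<close> by auto
  then have meet: "S \<inter> T \<subseteq> convex hull (set vs)"
    unfolding A(2) by (rule hull_mono)
  have "{1..Suc d} = Suc ` {..d}"
    by (simp add: atMost_atLeast0)
  then have tail: "?u ` {1..Suc d} = set vs"
    using image_nth_atMost[OF vs(2)] by (simp only: image_image nth_Cons_Suc)
  have "simplex_vertices (Suc d) ?u" "simplex_vertices (Suc d) ((!) (b # vs))"
    using embedded_simplex_nth[of "a # vs" f] embedded_simplex_nth[of "b # vs" f] vs a(1) b(1) Sh Th fS fT
    by (auto simp: embedded_simplex_def)
  then have "simplex_degree f (?u(0 := b)) = - simplex_degree f ?u"
    using fST meet by (intro simplex_degree_adjacent) (simp_all only: upd imu imv tail flip: Sh(2) Th(2))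
  then show ?thesis
    unfolding a(3) b(3) upd .
qed

end

subsection \<open>Randomised rounding\<close>

text \<open>The integrand is \<open>\<lfloor>a\<rfloor>\<close> on a stretch of length
  \<open>1 - frac a\<close> and larger by one on the remaining length \<open>frac a\<close>.\<close>

lemma has_integral_floor_shift: "((\<lambda>\<theta>. real_of_int \<lfloor>a + \<theta>\<rfloor>) has_integral a) {0..1}"
proof -
  let ?t = "1 - frac a"
  have t: "0 < ?t" "?t \<le> 1"
    using frac_lt_1[of a] frac_ge_0[of a] by linarith+
  have "((\<lambda>\<theta>. real_of_int \<lfloor>a + \<theta>\<rfloor>) has_integral ?t * real_of_int \<lfloor>a\<rfloor>) {0..?t}"
  \<comment> \<open>At the right end point the floor has already jumped, so that point is left
    out.\<close>
  proof (rule has_integral_spike_finite[of "{?t}"])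
    show "((\<lambda>\<theta>. real_of_int \<lfloor>a\<rfloor>) has_integral ?t * real_of_int \<lfloor>a\<rfloor>) {0..?t}"
      using has_integral_const_real[of "real_of_int \<lfloor>a\<rfloor>" 0 ?t] t by simp
    show "real_of_int \<lfloor>a + \<theta>\<rfloor> = real_of_int \<lfloor>a\<rfloor>" if "\<theta> \<in> {0..?t} - {?t}" for \<theta>
    proof -
      have "\<lfloor>a + \<theta>\<rfloor> = \<lfloor>a\<rfloor>"
        by (rule floor_unique) (use that in \<open>auto simp: frac_def\<close>, linarith)
      then show ?thesis by simp
    qed
  qed simp
  moreover have "((\<lambda>\<theta>. real_of_int \<lfloor>a + \<theta>\<rfloor>) has_integral (1 - ?t) * (real_of_int \<lfloor>a\<rfloor> + 1)) {?t..1}"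
  proof (rule has_integral_eq)
    show "((\<lambda>\<theta>. real_of_int \<lfloor>a\<rfloor> + 1) has_integral (1 - ?t) * (real_of_int \<lfloor>a\<rfloor> + 1)) {?t..1}"
      using has_integral_const_real[of "real_of_int \<lfloor>a\<rfloor> + 1" ?t 1] t by simp
    show "real_of_int \<lfloor>a\<rfloor> + 1 = real_of_int \<lfloor>a + \<theta>\<rfloor>" if "\<theta> \<in> {?t..1}" for \<theta>
    proof -
      have "\<lfloor>a + \<theta>\<rfloor> = \<lfloor>a\<rfloor> + 1"
        by (rule floor_unique) (use that in \<open>auto simp: frac_def\<close>, linarith)
      then show ?thesis by simp
    qed
  qed
  ultimately have "((\<lambda>\<theta>. real_of_int \<lfloor>a + \<theta>\<rfloor>) has_integral
      ?t * real_of_int \<lfloor>a\<rfloor> + (1 - ?t) * (real_of_int \<lfloor>a\<rfloor> + 1)) {0..1}"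
    by (rule has_integral_combine[rotated 2]) (use t in auto)
  moreover have "?t * real_of_int \<lfloor>a\<rfloor> + (1 - ?t) * (real_of_int \<lfloor>a\<rfloor> + 1) = a"
    by (simp add: frac_def algebra_simps)
  ultimately show ?thesis by simp
qed

text \<open>For integral \<open>c\<close> the absolute value is linear on the interval spanned by the two values
  that the integrand takes before the absolute value is applied.\<close>

lemma has_integral_abs_floor_shift:
  fixes c :: int and a b :: real
  shows "((\<lambda>\<theta>. \<bar>c + (real_of_int \<lfloor>a + \<theta>\<rfloor> - real_of_int \<lfloor>b + \<theta>\<rfloor>)\<bar>) has_integral \<bar>c + (a - b)\<bar>) {0..1}"
proof -
  let ?k = "\<lambda>\<theta>. c + (real_of_int \<lfloor>a + \<theta>\<rfloor> - real_of_int \<lfloor>b + \<theta>\<rfloor>)"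
  have "((\<lambda>\<theta>::real. real_of_int c) has_integral real_of_int c) {0..1}"
    using has_integral_const_real[of "real_of_int c" 0 1] by simp
  then have k: "(?k has_integral c + (a - b)) {0..1}"
    by (intro has_integral_add has_integral_diff has_integral_floor_shift)
  have m: "\<lfloor>a - b\<rfloor> \<le> \<lfloor>a + \<theta>\<rfloor> - \<lfloor>b + \<theta>\<rfloor>" "\<lfloor>a + \<theta>\<rfloor> - \<lfloor>b + \<theta>\<rfloor> \<le> \<lfloor>a - b\<rfloor> + 1" for \<theta>
    by linarith+
  show ?thesis
  proof (cases "0 \<le> c + \<lfloor>a - b\<rfloor>")
    case True
    have 1: "\<bar>?k \<theta>\<bar> = ?k \<theta>" for \<theta>
      using True m[of \<theta>] by linarith
    have 2: "\<bar>c + (a - b)\<bar> = c + (a - b)"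
      using True by linarith
    show ?thesis unfolding 1 2 by (rule k)
  next
    case False
    have 1: "\<bar>?k \<theta>\<bar> = - ?k \<theta>" for \<theta>
      using False m[of \<theta>] by linarith
    have 2: "\<bar>c + (a - b)\<bar> = - (c + (a - b))"
      using False by linarith
    show ?thesis unfolding 1 2 by (rule has_integral_neg[OF k])
  qed
qed

text \<open>Two columns with the same nonzero entry would have to be opposite, so each sign occurs
  at most once. Taking \<open>P\<close> and \<open>N\<close> as sets treats rows with fewer than two
  entries uniformly, through empty sums.\<close>

lemma sum_opposite_signs:
  fixes m :: "'c \<Rightarrow> int"
  assumes "finite B" "\<And>S. S \<in> B \<Longrightarrow> m S \<in> {-1, 0, 1}"
    and "\<And>S T. \<lbrakk>S \<in> B; T \<in> B; S \<noteq> T; m S \<noteq> 0; m T \<noteq> 0\<rbrakk> \<Longrightarrow> m T = - m S"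
  obtains P N where "P \<subseteq> B" "N \<subseteq> B" "card P \<le> 1" "card N \<le> 1"
    "\<And>h :: 'c \<Rightarrow> real. (\<Sum>S\<in>B. m S * h S) = sum h P - sum h N"
proof
  let ?P = "{S \<in> B. m S = 1}" and ?N = "{S \<in> B. m S = -1}"
  show "?P \<subseteq> B" "?N \<subseteq> B" by auto
  have "card {S \<in> B. m S = k} \<le> 1" if "k \<noteq> 0" for k
  proof -
    have "S = T" if "S \<in> B" "m S = k" "T \<in> B" "m T = k" for S T
      using assms(3)[of S T] that \<open>k \<noteq> 0\<close> by (cases "S = T") auto
    then have "\<forall>S\<in>{S \<in> B. m S = k}. \<forall>T\<in>{S \<in> B. m S = k}. S = T"
      by blast
    moreover have "finite {S \<in> B. m S = k}"
      using assms(1) by simp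
    ultimately show ?thesis
      unfolding One_nat_def by (rule card_le_Suc0_iff_eq[THEN iffD2, rotated])
  qed
  then show "card ?P \<le> 1" "card ?N \<le> 1" by auto
  fix h :: "'c \<Rightarrow> real"
  have "(\<Sum>S\<in>B. m S * h S) = (\<Sum>S\<in>B. (if m S = 1 then h S else 0) - (if m S = -1 then h S else 0))"
    by (rule sum.cong) (use assms(2) in fastforce)+
  then show "(\<Sum>S\<in>B. m S * h S) = sum h ?P - sum h ?N"
    using assms(1) by (simp add: sum_subtractf sum.inter_filter)
qed

text \<open>The bound \<open>v\<close> holds at the rounded point for every \<theta>, hence on
  average, and the average of the rounded objective is its value at \<open>y\<close>.\<close>

lemma integral_minimum_le_real:
  fixes M :: "'r \<Rightarrow> 'c \<Rightarrow> int" and \<epsilon> :: "'c \<Rightarrow> int" and c :: "'r \<Rightarrow> int" and w :: "'r \<Rightarrow> real" and y :: "'c \<Rightarrow> real"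
  assumes fin: "finite A" "finite B" and \<epsilon>: "\<And>S. S \<in> B \<Longrightarrow> \<bar>\<epsilon> S\<bar> = 1"
    and M: "\<And>F S. \<lbrakk>F \<in> A; S \<in> B\<rbrakk> \<Longrightarrow> M F S \<in> {-1, 0, 1}"
    and opp: "\<And>F S T. \<lbrakk>F \<in> A; S \<in> B; T \<in> B; S \<noteq> T; M F S \<noteq> 0; M F T \<noteq> 0\<rbrakk> \<Longrightarrow> M F T * \<epsilon> T = - (M F S * \<epsilon> S)"
    and min: "\<And>z :: 'c \<Rightarrow> int. v \<le> (\<Sum>F\<in>A. w F * \<bar>c F + (\<Sum>S\<in>B. real_of_int (M F S) * real_of_int (z S))\<bar>)"
  shows "v \<le> (\<Sum>F\<in>A. w F * \<bar>c F + (\<Sum>S\<in>B. real_of_int (M F S) * y S)\<bar>)"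
proof -
  define y' where "y' = (\<lambda>S. \<epsilon> S * y S)"
  \<comment> \<open>Subtracting \<open>\<lfloor>\<theta>\<rfloor>\<close> cancels in a difference of
    two floors and makes 0 round to 0 even at \<open>\<theta> = 1\<close>, so that an empty
    \<open>P\<close> or \<open>N\<close> fits the same formula. The factor
    \<open>\<epsilon> S\<close> undoes the change of sign of the column.\<close>
  define z where "z = (\<lambda>\<theta> S. \<epsilon> S * (\<lfloor>y' S + \<theta>\<rfloor> - \<lfloor>\<theta>\<rfloor>))"
  have \<epsilon>\<epsilon>: "real_of_int (\<epsilon> S) * real_of_int (\<epsilon> S) = 1" if "S \<in> B" for S
    using \<epsilon>[OF that] by (auto simp: abs_if split: if_splits)
  have row: "((\<lambda>\<theta>. \<bar>c F + (\<Sum>S\<in>B. real_of_int (M F S) * real_of_int (z \<theta> S))\<bar>) has_integral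
      \<bar>c F + (\<Sum>S\<in>B. real_of_int (M F S) * y S)\<bar>) {0..1}" if F: "F \<in> A" for F
  proof -
    have m: "M F S * \<epsilon> S \<in> {-1, 0, 1}" if "S \<in> B" for S
      using \<epsilon>[OF that] M[OF F that] by (auto simp: abs_if split: if_splits)
    obtain P N where PN: "P \<subseteq> B" "N \<subseteq> B" "card P \<le> 1" "card N \<le> 1"
      and sum: "\<And>h. (\<Sum>S\<in>B. real_of_int (M F S * \<epsilon> S) * h S) = sum h P - sum h N"
    proof (rule sum_opposite_signs[OF fin(2) m])
      show "M F T * \<epsilon> T = - (M F S * \<epsilon> S)"
        if "S \<in> B" "T \<in> B" "S \<noteq> T" "M F S * \<epsilon> S \<noteq> 0" "M F T * \<epsilon> T \<noteq> 0" for S T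
        using opp[OF F that(1-3)] that by simp
    qed blast+
    have floor_sum: "(\<Sum>S\<in>Q. real_of_int (\<lfloor>y' S + \<theta>\<rfloor> - \<lfloor>\<theta>\<rfloor>)) = \<lfloor>sum y' Q + \<theta>\<rfloor> - \<lfloor>\<theta>\<rfloor>"
      if "card Q \<le> 1" "Q \<subseteq> B" for Q \<theta>
    proof -
      have "finite Q" using that(2) fin(2) finite_subset by blast
      with that(1) consider "Q = {}" | S where "Q = {S}"
        by (metis card_0_eq card_1_singletonE le_Suc_eq le_zero_eq One_nat_def)
      then show ?thesis by cases auto
    qed
    have "(\<Sum>S\<in>B. real_of_int (M F S) * real_of_int (z \<theta> S)) = \<lfloor>sum y' P + \<theta>\<rfloor> - \<lfloor>sum y' N + \<theta>\<rfloor>" for \<theta>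
      using sum[of "\<lambda>S. real_of_int (\<lfloor>y' S + \<theta>\<rfloor> - \<lfloor>\<theta>\<rfloor>)"] floor_sum[OF PN(3,1), of \<theta>] floor_sum[OF PN(4,2), of \<theta>]
      by (simp add: z_def mult.assoc)
    moreover have "(\<Sum>S\<in>B. real_of_int (M F S) * y S) = sum y' P - sum y' N"
    proof -
      have "(\<Sum>S\<in>B. real_of_int (M F S) * y S) = (\<Sum>S\<in>B. real_of_int (M F S * \<epsilon> S) * y' S)"
      proof (rule sum.cong)
        fix S assume "S \<in> B"
        have "real_of_int (M F S * \<epsilon> S) * y' S
            = real_of_int (M F S) * (real_of_int (\<epsilon> S) * real_of_int (\<epsilon> S)) * y S"
          by (simp add: y'_def)
        then show "real_of_int (M F S) * y S = real_of_int (M F S * \<epsilon> S) * y' S"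
          by (simp only: \<epsilon>\<epsilon>[OF \<open>S \<in> B\<close>] mult_1_right)
      qed simp
      then show ?thesis using sum[of y'] by simp
    qed
    ultimately show ?thesis
      using has_integral_abs_floor_shift[of "c F" "sum y' P" "sum y' N"] by simp
  qed
  have "((\<lambda>\<theta>::real. v) has_integral v) {0..1}"
    using has_integral_const_real[of v 0 1] by simp
  moreover have "((\<lambda>\<theta>. \<Sum>F\<in>A. w F * \<bar>c F + (\<Sum>S\<in>B. real_of_int (M F S) * real_of_int (z \<theta> S))\<bar>) has_integral
      (\<Sum>F\<in>A. w F * \<bar>c F + (\<Sum>S\<in>B. real_of_int (M F S) * y S)\<bar>)) {0..1}"
    by (intro has_integral_sum fin(1) has_integral_mult_right row)
  ultimately show ?thesis
    by (rule has_integral_le) (rule min)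
qed

section \<open>Existence of an optimal integer chain\<close>

text \<open>Values are counted instead of vectors \<open>n\<close>, since a vanishing weight admits
  infinitely many vectors with one value. All summands are nonnegative, so the parts of a sum
  bounded by \<open>C\<close> are bounded by \<open>C\<close> too.\<close>

lemma finite_weighted_sums_below:
  fixes w :: "'r \<Rightarrow> real"
  assumes "finite A" "\<And>F. F \<in> A \<Longrightarrow> 0 \<le> w F"
  shows "finite {v. v \<le> C \<and> (\<exists>n :: 'r \<Rightarrow> nat. v = (\<Sum>F\<in>A. w F * n F))}"
  using assms
proof (induction A rule: finite_induct)
  case empty
  then show ?case by (auto intro: finite_subset[of _ "{0}"])
next
  case (insert F A)
  let ?V = "\<lambda>A. {v. v \<le> C \<and> (\<exists>n :: 'r \<Rightarrow> nat. v = (\<Sum>F\<in>A. w F * n F))}"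
  let ?X = "{w F * real k | k. w F * real k \<le> C}"
  have "finite ?X"
  proof (cases "w F = 0")
    case False
    with insert.prems have pos: "w F > 0" by force
    have "?X \<subseteq> (\<lambda>k. w F * real k) ` {..nat \<lceil>C / w F\<rceil>}"
    proof clarsimp
      fix k assume "w F * real k \<le> C"
      then have "real k \<le> C / w F"
        using pos by (simp add: pos_le_divide_eq mult.commute)
      then have "k \<le> nat \<lceil>C / w F\<rceil>"
        by linarith
      then show "w F * real k \<in> (\<lambda>k. w F * real k) ` {..nat \<lceil>C / w F\<rceil>}" by blast
    qed
    then show ?thesis using finite_subset by blast
  qed (auto intro: finite_subset[of _ "{0}"])
  moreover have "finite (?V A)" using insert by auto
  moreover have "?V (insert F A) \<subseteq> (\<lambda>(x, y). x + y) ` (?X \<times> ?V A)"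
  proof
    fix v assume "v \<in> ?V (insert F A)"
    then obtain n :: "'r \<Rightarrow> nat" where n: "v \<le> C" "v = w F * n F + (\<Sum>F\<in>A. w F * n F)"
      using insert.hyps by auto
    have "0 \<le> w F * n F" "0 \<le> (\<Sum>F\<in>A. w F * n F)"
      using insert.prems by (auto intro!: sum_nonneg)
    then have "w F * n F \<in> ?X" "(\<Sum>F\<in>A. w F * n F) \<in> ?V A"
      using n by auto
    then show "v \<in> (\<lambda>(x, y). x + y) ` (?X \<times> ?V A)"
      using n(2) by force
  qed
  ultimately show ?case
    by (meson finite_SigmaI finite_imageI finite_subset)
qed

lemma weighted_sum_minimum:
  fixes w :: "'r \<Rightarrow> real" and g :: "'z \<Rightarrow> 'r \<Rightarrow> int"
  assumes "finite A" "\<And>F. F \<in> A \<Longrightarrow> 0 \<le> w F"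
  obtains z where "\<And>z'. (\<Sum>F\<in>A. w F * \<bar>real_of_int (g z F)\<bar>) \<le> (\<Sum>F\<in>A. w F * \<bar>real_of_int (g z' F)\<bar>)"
proof -
  let ?J = "\<lambda>z. \<Sum>F\<in>A. w F * \<bar>real_of_int (g z F)\<bar>"
  \<comment> \<open>\<open>undefined\<close> is just some starting point; only values not above its
    own compete for the minimum.\<close>
  let ?V = "{v \<in> range ?J. v \<le> ?J undefined}"
  have "\<exists>n :: 'r \<Rightarrow> nat. ?J z = (\<Sum>F\<in>A. w F * n F)" for z
    by (rule exI[of _ "\<lambda>F. nat \<bar>g z F\<bar>"]) simp
  then have "?V \<subseteq> {v. v \<le> ?J undefined \<and> (\<exists>n :: 'r \<Rightarrow> nat. v = (\<Sum>F\<in>A. w F * n F))}"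
    by auto
  then have "finite ?V"
    using finite_weighted_sums_below[OF assms] by (rule finite_subset)
  moreover have "?J undefined \<in> ?V" by blast
  ultimately have V: "Min ?V \<in> ?V" "\<And>v. v \<in> ?V \<Longrightarrow> Min ?V \<le> v"
    using Min_in Min_le by blast+
  then obtain z where "Min ?V = ?J z" by blast
  moreover have "Min ?V \<le> ?J z'" for z'
    using V(2)[of "?J z'"] V(2)[OF \<open>?J undefined \<in> ?V\<close>] by (cases "?J z' \<le> ?J undefined") auto
  ultimately show ?thesis using that by metis
qed

section \<open>From the embedding to the linear program\<close>

lemma embedding_map_euclideanD:
  assumes "embedding_map (top_of_set X) euclidean f"
  shows "continuous_on X f" "inj_on f X"
  using homeomorphic_imp_continuous_map[OF assms[unfolded embedding_map_def]]
    homeomorphic_imp_injective_map[OF assms[unfolded embedding_map_def]]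
  by (auto simp: continuous_map_in_subtopology)

text \<open>The witness for \<open>\<epsilon> S\<close> is the degree of \<open>S\<close> in the
  ordering \<open>ori S\<close>: reorienting \<open>S\<close> changes the column and its sign
  together.\<close>

lemma boundary_matrix_coherent_signs:
  fixes K :: "'a::euclidean_space set set" and f :: "'a \<Rightarrow> 'b::euclidean_space"
  assumes K: "simplicial_complex K" and dim: "DIM('b) = d + 1"
    and f: "continuous_on (\<Union>K) f" "inj_on f (\<Union>K)" and ori: "orientation K ori"
  obtains \<epsilon> where "\<And>S. S \<in> simplices K (d + 1) \<Longrightarrow> \<bar>\<epsilon> S\<bar> = (1::int)"
    and "\<And>F S. \<lbrakk>F \<in> simplices K d; S \<in> simplices K (d + 1)\<rbrakk> \<Longrightarrow> boundary_matrix K ori (d + 1) F S \<in> {-1, 0, 1}"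
    and "\<And>F S T. \<lbrakk>F \<in> simplices K d; S \<in> simplices K (d + 1); T \<in> simplices K (d + 1); S \<noteq> T;
        boundary_matrix K ori (d + 1) F S \<noteq> 0; boundary_matrix K ori (d + 1) F T \<noteq> 0\<rbrakk>
      \<Longrightarrow> boundary_matrix K ori (d + 1) F T * \<epsilon> T = - (boundary_matrix K ori (d + 1) F S * \<epsilon> S)"
proof -
  obtain \<beta> :: "nat \<Rightarrow> 'b" where "bij_betw \<beta> {0..<DIM('b)} Basis"
    using ex_bij_betw_nat_finite[OF finite_Basis] by blast
  moreover have "{0..<DIM('b)} = {..d}"
    unfolding dim by auto
  ultimately have "bij_betw \<beta> {..d} Basis"
    by (simp only:)
  then interpret orthonormal_frame \<beta> d
    by (rule orthonormal_frame.intro)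
  have fS: "continuous_on S f" "inj_on f S" if "S \<in> simplices K (d + 1)" for S
  proof -
    have "S \<subseteq> \<Union>K" using that by (auto simp: simplices_def)
    then show "continuous_on S f" "inj_on f S"
      using continuous_on_subset[OF f(1)] inj_on_subset[OF f(2)] by auto
  qed
  have fin: "finite K" using K by (simp add: simplicial_complex_def)
  show ?thesis
  proof (rule that)
    show "\<bar>simplex_degree f ((!) (ori S))\<bar> = 1" if S: "S \<in> simplices K (d + 1)" for S
    proof -
      note o = orientation_simplex[OF ori S]
      have "embedded_simplex f ((!) (ori S))"
        using o fS[OF S] by (intro embedded_simplex_nth) simp_all
      then show ?thesis
        unfolding embedded_simplex_def by (intro abs_simplex_degree) auto
    qed
    show "boundary_matrix K ori (d + 1) F S \<in> {-1, 0, 1}"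
      if "F \<in> simplices K d" "S \<in> simplices K (d + 1)" for F S
      using boundary_matrix_simplex_degree[OF fin ori that fS[OF that(2)]] by blast
  qed (rule boundary_matrix_opposite[OF K ori _ _ _ _ f])
qed

theorem corollary5p8:
  fixes K :: "'a::euclidean_space set set"
    and f :: "'a \<Rightarrow> real ^ 'n"
    and d :: nat
    and ori :: "'a set \<Rightarrow> 'a list"
    and w :: "'a set \<Rightarrow> real"
    and c :: "'a set \<Rightarrow> int"
  assumes "simplicial_complex K"
    and "CARD('n) = d + 1"
    and "embedding_map (top_of_set (\<Union>K)) euclidean f"
    and "orientation K ori"
  shows "(\<exists>xp xm y :: 'a set \<Rightarrow> int.
            lp_optimal K ori d w c
              (\<lambda>F. real_of_int (xp F)) (\<lambda>F. real_of_int (xm F)) (\<lambda>S. real_of_int (y S))) \<and>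
         (\<forall>xp xm y :: 'a set \<Rightarrow> int.
            lp_optimal K ori d w c
              (\<lambda>F. real_of_int (xp F)) (\<lambda>F. real_of_int (xm F)) (\<lambda>S. real_of_int (y S)) \<longrightarrow>
            optimal_chain K ori d w c (\<lambda>F. xp F - xm F))"
proof -
  define A where "A = simplices K d"
  define B where "B = simplices K (d + 1)"
  define M where "M = boundary_matrix K ori (d + 1)"
  define chain where "chain = (\<lambda>(y :: 'a set \<Rightarrow> int) F. c F + (\<Sum>S\<in>B. M F S * y S))"
  define J where "J = (\<lambda>x :: 'a set \<Rightarrow> int. \<Sum>F\<in>A. \<bar>w F\<bar> * \<bar>real_of_int (x F)\<bar>)"
  have fin: "finite A" "finite B"
    using assms(1) by (simp_all add: A_def B_def simplices_def simplicial_complex_def)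
  have J: "J x = (\<Sum>F\<in>A. \<bar>w F\<bar> * \<bar>real_of_int (x F)\<bar>)" for x
    by (simp add: J_def)
  have of_chain: "real_of_int (chain y F)
      = real_of_int (c F) + (\<Sum>S\<in>B. real_of_int (M F S) * real_of_int (y S))" for y F
    by (simp add: chain_def)
  have feasible_split: "lp_feasible K ori d c (\<lambda>F. real_of_int (max (x F) 0))
      (\<lambda>F. real_of_int (max (- x F) 0)) (\<lambda>S. real_of_int (y S))"
    if "\<And>F. F \<in> A \<Longrightarrow> x F = chain y F" for x y
    unfolding lp_feasible_def A_def[symmetric] B_def[symmetric] M_def[symmetric] of_chain[symmetric]
    by (auto simp: max_def simp flip: that)
  have objective_split: "lp_objective K d w (\<lambda>F. real_of_int (max (x F) 0))
      (\<lambda>F. real_of_int (max (- x F) 0)) = J x" for x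
    unfolding lp_objective_def A_def[symmetric] J_def by (intro sum.cong) auto
  have objective_ge: "(\<Sum>F\<in>A. \<bar>w F\<bar> * \<bar>xp F - xm F\<bar>) \<le> lp_objective K d w xp xm"
    if "\<And>F. F \<in> A \<Longrightarrow> 0 \<le> xp F \<and> 0 \<le> xm F" for xp xm
    unfolding lp_objective_def A_def[symmetric]
    by (intro sum_mono mult_left_mono) (use that in force)+
  \<comment> \<open>The candidate is chosen among integer chains only; \<open>lower\<close> then
    shows that no real feasible point does better, which also proves that the linear program has an
    optimum.\<close>
  obtain z where z: "\<And>z'. J (chain z) \<le> J (chain z')"
    unfolding J_def by (rule weighted_sum_minimum[OF fin(1), of "\<lambda>F. \<bar>w F\<bar>" chain]) auto
  note f = embedding_map_euclideanD[OF assms(3)]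
  obtain \<epsilon> where signs: "\<And>S. S \<in> B \<Longrightarrow> \<bar>\<epsilon> S\<bar> = (1::int)" "\<And>F S. \<lbrakk>F \<in> A; S \<in> B\<rbrakk> \<Longrightarrow> M F S \<in> {-1, 0, 1}"
    "\<And>F S T. \<lbrakk>F \<in> A; S \<in> B; T \<in> B; S \<noteq> T; M F S \<noteq> 0; M F T \<noteq> 0\<rbrakk> \<Longrightarrow> M F T * \<epsilon> T = - (M F S * \<epsilon> S)"
    using boundary_matrix_coherent_signs[OF assms(1) _ f assms(4), of d] assms(2)
    unfolding A_def B_def M_def by auto
  have lower: "J (chain z) \<le> lp_objective K d w xp xm" if feas: "lp_feasible K ori d c xp xm y" for xp xm y
  proof -
    have xpm: "xp F - xm F = real_of_int (c F) + (\<Sum>S\<in>B. real_of_int (M F S) * y S)" "0 \<le> xp F \<and> 0 \<le> xm F"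
      if "F \<in> A" for F
      using feas that by (auto simp: lp_feasible_def A_def B_def M_def)
    have "J (chain z) \<le> (\<Sum>F\<in>A. \<bar>w F\<bar> * \<bar>real_of_int (c F) + (\<Sum>S\<in>B. real_of_int (M F S) * y S)\<bar>)"
    proof (rule integral_minimum_le_real[OF fin signs])
      show "J (chain z) \<le> (\<Sum>F\<in>A. \<bar>w F\<bar> * \<bar>real_of_int (c F) + (\<Sum>S\<in>B. real_of_int (M F S) * real_of_int (z' S))\<bar>)" for z'
        using z[of z'] by (simp only: J of_chain)
    qed
    also have "\<dots> = (\<Sum>F\<in>A. \<bar>w F\<bar> * \<bar>xp F - xm F\<bar>)"
      by (intro sum.cong) (auto simp: xpm(1))
    also have "\<dots> \<le> lp_objective K d w xp xm"
      by (rule objective_ge) (rule xpm(2))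
    finally show ?thesis .
  qed
  have z_optimal: "lp_optimal K ori d w c (\<lambda>F. real_of_int (max (chain z F) 0))
      (\<lambda>F. real_of_int (max (- chain z F) 0)) (\<lambda>S. real_of_int (z S))"
    unfolding lp_optimal_def objective_split using feasible_split[of "chain z" z] lower by blast
  have chain_optimal: "optimal_chain K ori d w c (\<lambda>F. xp F - xm F)"
    if opt: "lp_optimal K ori d w c (\<lambda>F. real_of_int (xp F))
        (\<lambda>F. real_of_int (xm F)) (\<lambda>S. real_of_int (y S))" for xp xm y
  proof -
    have xpm: "real_of_int (xp F) - real_of_int (xm F) = real_of_int (chain y F)" "0 \<le> xp F \<and> 0 \<le> xm F"
      if "F \<in> A" for F
      using opt that by (auto simp: lp_optimal_def lp_feasible_def A_def B_def M_def chain_def)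
    have hom: "homologous K ori d c (\<lambda>F. xp F - xm F)"
      unfolding homologous_def
    proof (intro exI[of _ y] ballI)
      fix F assume "F \<in> simplices K d"
      then have "xp F - xm F = chain y F"
        using xpm(1)[of F] by (simp only: A_def of_int_diff[symmetric] of_int_eq_iff)
      then show "xp F - xm F = c F + (\<Sum>S\<in>simplices K (d + 1). boundary_matrix K ori (d + 1) F S * y S)"
        by (simp only: chain_def B_def M_def)
    qed
    \<comment> \<open>Any homologous chain, split into positive and negative parts, is feasible with
      its weighted norm as objective, while the objective of \<open>xp\<close> and \<open>xm\<close>
      is at least the weighted norm of their difference.\<close>
    have "J (\<lambda>F. xp F - xm F) \<le> J x'" if hom': "homologous K ori d c x'" for x'
    proof -
      obtain y' where "\<forall>F\<in>A. x' F = chain y' F"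
        using hom' unfolding homologous_def chain_def A_def B_def M_def by (elim exE)
      then have y': "x' F = chain y' F" if "F \<in> A" for F
        using that by (rule bspec)
      have "J (\<lambda>F. xp F - xm F) \<le> lp_objective K d w (\<lambda>F. real_of_int (xp F)) (\<lambda>F. real_of_int (xm F))"
        using objective_ge[of "\<lambda>F. real_of_int (xp F)" "\<lambda>F. real_of_int (xm F)"] xpm(2) by (simp add: J_def)
      also have "\<dots> \<le> J x'"
        using opt feasible_split[OF y'] unfolding lp_optimal_def objective_split[symmetric] by blast
      finally show ?thesis .
    qed
    then show ?thesis
      using hom by (simp add: optimal_chain_def J_def A_def)
  qed
  show ?thesis
    by (intro conjI exI[of _ z] exI allI impI) (rule z_optimal, rule chain_optimal)
qed

end
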